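(* Let $d\ge 2$ and let $(\rho,v)$ be a smooth solution on $\mathbb{R}^d$ of the stationary barotropic compressible Navier–Stokes system $$\nabla\cdot(\rho v)=0,\qquad \nabla\cdot(\rho v\otimes v)=-\nabla P+\mu\Delta v+(\mu+\lambda)\nabla(\nabla\cdot v),\qquad P=A\rho^\gamma ,$$ satisfying $$\|\rho\|_{L^\infty(\mathbb{R}^d)}+\|v\|_{L^{\frac{d}{d-1}}(\mathbb{R}^d)}+\|v\|_{L^{\frac{3d}{d-1}}(\mathbb{R}^d)}<\infty .$$ Then $v\equiv 0$ and $\rho$ is constant on $\mathbb{R}^d$.
   Context: $\rho:\mathbb{R}^d\to[0,\infty)$ is the density, $v:\mathbb{R}^d\to\mathbb{R}^d$ the velocity, $P$ the pressure. The constants satisfy $\mu>0$, $\lambda+2\mu>0$, $A>0$, $\gamma>1$. $(\nabla\cdot(\rho v\otimes v))_j=\sum_i\partial_i(\rho v_iv_j)$. *)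

theory Defs
  imports "HOL-Analysis.Analysis"
begin

definition partial :: "'n::finite \<Rightarrow> (real^'n \<Rightarrow> real) \<Rightarrow> real^'n \<Rightarrow> real" where
  "partial i f x = frechet_derivative f (at x) (axis i 1)"

fun iter_partial :: "'n::finite list \<Rightarrow> (real^'n \<Rightarrow> real) \<Rightarrow> real^'n \<Rightarrow> real" where
  "iter_partial [] f = f"
| "iter_partial (i # is) f = partial i (iter_partial is f)"

definition smooth :: "(real^'n::finite \<Rightarrow> real) \<Rightarrow> bool" where
  "smooth f \<longleftrightarrow> (\<forall>is x. iter_partial is f differentiable (at x))"

definition smooth_field :: "(real^'n::finite \<Rightarrow> real^'n) \<Rightarrow> bool" where
  "smooth_field v \<longleftrightarrow> (\<forall>j. smooth (\<lambda>x. v x $ j))"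

end

theory Submission
  imports Defs
begin

text \<open>
  Dotting the momentum equation with \<open>v\<close> and using the mass equation, convection, pressure and
  viscosity combine into a single identity \<open>div G = - E\<close> with
  \<open>E = \<mu>/2 * \<bar>\<omega>\<bar>\<^sup>2 + (2 \<mu> + \<lambda>) * (div v)\<^sup>2\<close>, where \<open>\<omega>\<close> is the vorticity matrix
  \<open>\<partial>\<^sub>i v\<^sub>j - \<partial>\<^sub>j v\<^sub>i\<close>; splitting the viscous term into vorticity and divergence makes \<open>E\<close>
  nonnegative under \<open>\<lambda> + 2 \<mu> > 0\<close> alone. The flux satisfies \<open>\<bar>G\<bar> \<le> C (\<surd>E \<bar>v\<bar> + \<bar>v\<bar> + \<bar>v\<bar>\<^sup>3)\<close>. Testing with
  a cutoff at scale \<open>R\<close>, the first summand is absorbed by \<open>E\<close>, and the other two vanish as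
  \<open>R \<rightarrow> \<infinity>\<close> since \<open>\<bar>v\<bar>\<close> and \<open>\<bar>v\<bar>\<^sup>3\<close> lie in \<open>L\<^sup>p\<close> for \<open>p = d / (d - 1)\<close>, the exponent dual to \<open>L\<^sup>d\<close>, in
  which gradients of cutoffs are bounded. Hence \<open>\<omega> = 0\<close> and \<open>div v = 0\<close>, so \<open>v\<close> is harmonic and the same
  argument gives \<open>\<nabla>v = 0\<close>. A constant integrable field is zero, and then the pressure gradient
  vanishes.
\<close>

subsection \<open>Directional derivatives\<close>

text \<open>Only restrictions to lines parallel to \<open>a\<close> are differentiated. This suits
  the mean value theorem and difference quotients under translation, and is easy to verify for a
  truncated cutoff.\<close>

definition has_dir_deriv ::
    "('a::real_normed_vector \<Rightarrow> real) \<Rightarrow> 'a \<Rightarrow> ('a \<Rightarrow> real) \<Rightarrow> bool" where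
  "has_dir_deriv f a f' \<longleftrightarrow> (\<forall>x. ((\<lambda>t. f (x + t *\<^sub>R a)) has_real_derivative f' x) (at 0))"

lemma has_dir_derivD:
  assumes "has_dir_deriv f a f'"
  shows "((\<lambda>t. f (x + t *\<^sub>R a)) has_real_derivative f' (x + t *\<^sub>R a)) (at t)"
proof -
  have "((\<lambda>s. f ((x + t *\<^sub>R a) + s *\<^sub>R a)) has_real_derivative f' (x + t *\<^sub>R a)) (at 0)"
    using assms unfolding has_dir_deriv_def by blast
  then have "((\<lambda>s. f (x + (s + t) *\<^sub>R a)) has_real_derivative f' (x + t *\<^sub>R a)) (at 0)"
    by (simp add: algebra_simps)
  then show ?thesis
    using DERIV_shift[of "\<lambda>t. f (x + t *\<^sub>R a)" "f' (x + t *\<^sub>R a)" 0 t] by simp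
qed

lemma dir_deriv_MVT:
  assumes "has_dir_deriv f a f'" "0 < h"
  obtains t where "0 < t" "t < h" "f (x + h *\<^sub>R a) - f x = h * f' (x + t *\<^sub>R a)"
proof -
  have "\<exists>z>0. z < h \<and> f (x + h *\<^sub>R a) - f (x + 0 *\<^sub>R a) = (h - 0) * f' (x + z *\<^sub>R a)"
    using assms(2) by (intro MVT2 has_dir_derivD[OF assms(1)])
  then show ?thesis using that by auto
qed

text \<open>The mean value theorem, used along \<open>a\<close> for the increment in direction
  \<open>b\<close> and then along \<open>b\<close> for \<open>fa\<close>, turns the quotient into a
  value of \<open>fba\<close> at a point close to \<open>x\<close>.\<close>

lemma second_difference_tendsto:
  assumes fa: "has_dir_deriv f a fa" and fba: "has_dir_deriv fa b fba"
    and cont: "isCont fba x"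
  shows "((\<lambda>h. (f (x + h *\<^sub>R a + h *\<^sub>R b) - f (x + h *\<^sub>R a) - f (x + h *\<^sub>R b) + f x) / h\<^sup>2)
          \<longlongrightarrow> fba x) (at_right 0)"
proof (rule tendstoI)
  fix e :: real assume "e > 0"
  then obtain d where d: "d > 0" "\<And>y. dist y x < d \<Longrightarrow> dist (fba y) (fba x) < e"
    using cont unfolding continuous_at_eps_delta by blast
  \<comment> \<open>The intermediate point is within \<open>h * (norm a + norm b)\<close> of
    \<open>x\<close>; the summand 1 keeps the denominator positive when both directions are
    zero.\<close>
  define d' where "d' = d / (norm a + norm b + 1)"
  have d': "d' > 0"
    unfolding d'_def using d(1) by (intro divide_pos_pos) (auto intro: add_nonneg_pos)
  have "dist ((f (x + h *\<^sub>R a + h *\<^sub>R b) - f (x + h *\<^sub>R a) - f (x + h *\<^sub>R b) + f x) / h\<^sup>2)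
          (fba x) < e" if h: "0 < h" "h < d'" for h
  proof -
    have u: "has_dir_deriv (\<lambda>y. f (y + h *\<^sub>R b) - f y) a (\<lambda>y. fa (y + h *\<^sub>R b) - fa y)"
      unfolding has_dir_deriv_def
    proof
      fix y
      have "((\<lambda>t. f (y + h *\<^sub>R b + t *\<^sub>R a) - f (y + t *\<^sub>R a))
          has_real_derivative fa (y + h *\<^sub>R b) - fa y) (at 0)"
        using fa unfolding has_dir_deriv_def by (intro DERIV_diff) blast+
      then show "((\<lambda>t. f (y + t *\<^sub>R a + h *\<^sub>R b) - f (y + t *\<^sub>R a))
          has_real_derivative fa (y + h *\<^sub>R b) - fa y) (at 0)"
        by (simp add: add_ac)
    qed
    obtain t where t: "0 < t" "t < h"
      and t_eq: "f (x + h *\<^sub>R a + h *\<^sub>R b) - f (x + h *\<^sub>R a) - (f (x + h *\<^sub>R b) - f x)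
          = h * (fa (x + t *\<^sub>R a + h *\<^sub>R b) - fa (x + t *\<^sub>R a))"
      by (rule dir_deriv_MVT[OF u h(1)])
    obtain s where s: "0 < s" "s < h"
      and s_eq: "fa (x + t *\<^sub>R a + h *\<^sub>R b) - fa (x + t *\<^sub>R a) = h * fba (x + t *\<^sub>R a + s *\<^sub>R b)"
      by (rule dir_deriv_MVT[OF fba h(1)])
    have eq: "(f (x + h *\<^sub>R a + h *\<^sub>R b) - f (x + h *\<^sub>R a) - f (x + h *\<^sub>R b) + f x) / h\<^sup>2
        = fba (x + t *\<^sub>R a + s *\<^sub>R b)"
      using t_eq s_eq h(1) by (simp add: field_simps power2_eq_square)
    have "norm (t *\<^sub>R a + s *\<^sub>R b) \<le> h * norm a + h * norm b"
      using t s by (intro norm_triangle_mono) (auto intro: mult_right_mono)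
    also have "\<dots> \<le> h * (norm a + norm b + 1)"
      using h by (simp add: algebra_simps)
    also have "\<dots> < d' * (norm a + norm b + 1)"
      using h(2) by (intro mult_strict_right_mono) (auto intro: add_nonneg_pos)
    also have "\<dots> = d"
      using add_nonneg_pos[of "norm a + norm b" 1] by (simp add: d'_def)
    finally show ?thesis
      unfolding eq by (intro d(2)) (simp add: dist_norm add.assoc)
  qed
  then show "\<forall>\<^sub>F h in at_right 0. dist ((f (x + h *\<^sub>R a + h *\<^sub>R b) - f (x + h *\<^sub>R a)
      - f (x + h *\<^sub>R b) + f x) / h\<^sup>2) (fba x) < e"
    unfolding eventually_at_right_field using d' by blast
qed

text \<open>Schwarz's theorem: the second difference quotient is symmetric in \<open>a\<close> and
  \<open>b\<close>, so both mixed derivatives are its limit.\<close>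

lemma dir_deriv_commute:
  assumes "has_dir_deriv f a fa" "has_dir_deriv fa b fba"
    and "has_dir_deriv f b fb" "has_dir_deriv fb a fab"
    and "isCont fba x" "isCont fab x"
  shows "fab x = fba x"
proof -
  have "((\<lambda>h. (f (x + h *\<^sub>R a + h *\<^sub>R b) - f (x + h *\<^sub>R a) - f (x + h *\<^sub>R b) + f x) / h\<^sup>2)
          \<longlongrightarrow> fab x) (at_right 0)"
    using second_difference_tendsto[OF assms(3,4,6)] by (simp add: algebra_simps)
  then show ?thesis
    using second_difference_tendsto[OF assms(1,2,5)] tendsto_unique trivial_limit_at_right_real
    by blast
qed

section \<open>Integrals of compactly supported functions and of their derivatives\<close>

lemma integrable_compact_support:
  fixes f :: "'a::euclidean_space \<Rightarrow> real"
  assumes "continuous_on UNIV f" "\<And>x. R < norm x \<Longrightarrow> f x = 0"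
  shows "integrable lborel f"
proof -
  have "integrable lborel (\<lambda>x. indicator (cball 0 R) x *\<^sub>R f x)"
    using assms(1) by (intro borel_integrable_compact) (auto intro: continuous_on_subset)
  also have "(\<lambda>x. indicator (cball 0 R) x *\<^sub>R f x) = f"
    using assms(2) by (auto simp: fun_eq_iff indicator_def)
  finally show ?thesis .
qed

lemma integral_translate:
  fixes f :: "'a::euclidean_space \<Rightarrow> real"
  assumes "integrable lborel f"
  shows "integrable lborel (\<lambda>x. f (x + c))" "(\<integral>x. f (x + c) \<partial>lborel) = (\<integral>x. f x \<partial>lborel)"
proof -
  have eq: "lborel = distr lborel borel ((+) c)"
    by (simp add: lborel_distr_plus)
  have m: "f \<in> borel_measurable borel"
    using assms by auto
  have "integrable (distr lborel borel ((+) c)) f"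
    using assms eq by simp
  then show "integrable lborel (\<lambda>x. f (x + c))"
    by (subst (asm) integrable_distr_eq) (use m in \<open>auto simp: add.commute\<close>)
  have "(\<integral>x. f x \<partial>lborel) = (\<integral>x. f x \<partial>distr lborel borel ((+) c))"
    using eq by simp
  also have "\<dots> = (\<integral>x. f (c + x) \<partial>lborel)"
    by (subst integral_distr) (use m in auto)
  finally show "(\<integral>x. f (x + c) \<partial>lborel) = (\<integral>x. f x \<partial>lborel)"
    by (simp add: add.commute)
qed

text \<open>The difference quotients integrate to zero by translation invariance, and the compact
  support provides a dominating function.\<close>

lemma integral_dir_deriv_eq_0:
  fixes f f' :: "'a::euclidean_space \<Rightarrow> real"
  assumes deriv: "has_dir_deriv f a f'"
    and cont: "continuous_on UNIV f" "continuous_on UNIV f'"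
    and supp: "\<And>x. R < norm x \<Longrightarrow> f x = 0" "\<And>x. R < norm x \<Longrightarrow> f' x = 0"
  shows "(\<integral>x. f' x \<partial>lborel) = 0"
proof -
  define h where "h = (\<lambda>n. 1 / real (Suc n))"
  define q where "q = (\<lambda>n x. (f (x + h n *\<^sub>R a) - f x) / h n)"
  have h_pos: "h n > 0" and h_le: "h n \<le> 1" for n
    by (auto simp: h_def)
  have h_lim: "h \<longlonglongrightarrow> 0"
    unfolding h_def using LIMSEQ_inverse_real_of_nat by (simp add: inverse_eq_divide)
  have int_f: "integrable lborel f"
    using integrable_compact_support[OF cont(1) supp(1)] .
  have int_q: "integrable lborel (q n)" and q0: "(\<integral>x. q n x \<partial>lborel) = 0" for n
    unfolding q_def using int_f integral_translate[OF int_f] by auto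
  have "compact (f' ` cball 0 R)"
    using cont(2) by (intro compact_continuous_image) (auto intro: continuous_on_subset)
  then obtain B0 where B0: "\<And>x. norm x \<le> R \<Longrightarrow> \<bar>f' x\<bar> \<le> B0"
    unfolding compact_eq_bounded_closed bounded_iff by force
  \<comment> \<open>For negative \<open>R\<close> the ball is empty and \<open>B0\<close> is
    unconstrained, hence the maximum with 0.\<close>
  define B where "B = max B0 0"
  have B: "\<bar>f' x\<bar> \<le> B" for x
    using B0[of x] supp(2)[of x] by (cases "norm x \<le> R") (auto simp: B_def)
  \<comment> \<open>Since \<open>h n\<close> is at most 1, a difference quotient at \<open>x\<close>
    sees only points within \<open>norm a\<close> of \<open>x\<close>; this ball contains all their
    supports.\<close>
  let ?K = "cball 0 (R + norm a) :: 'a set"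
  have bound: "\<bar>q n x\<bar> \<le> indicator ?K x *\<^sub>R B" for n x
  proof -
    obtain t where t: "0 < t" "t < h n"
      and eq: "f (x + h n *\<^sub>R a) - f x = h n * f' (x + t *\<^sub>R a)"
      by (rule dir_deriv_MVT[OF deriv h_pos])
    have q: "q n x = f' (x + t *\<^sub>R a)"
      using eq h_pos[of n] by (simp add: q_def)
    show ?thesis
    proof (cases "x \<in> ?K")
      case True
      then show ?thesis using B q by simp
    next
      case False
      have "norm x \<le> norm (x + t *\<^sub>R a) + norm (t *\<^sub>R a)"
        using norm_triangle_ineq4[of "x + t *\<^sub>R a" "t *\<^sub>R a"] by simp
      also have "norm (t *\<^sub>R a) \<le> 1 * norm a"
        unfolding norm_scaleR using t h_le[of n] by (intro mult_right_mono) auto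
      finally have "R < norm (x + t *\<^sub>R a)"
        using False by simp
      then show ?thesis using False supp(2) q by simp
    qed
  qed
  have "(\<lambda>n. \<integral>x. q n x \<partial>lborel) \<longlonglongrightarrow> (\<integral>x. f' x \<partial>lborel)"
  proof (rule integral_dominated_convergence)
    show "f' \<in> borel_measurable lborel"
      using cont(2) by (auto intro: borel_measurable_continuous_onI)
    show "integrable lborel (\<lambda>x. indicator ?K x *\<^sub>R B)"
      by (intro borel_integrable_compact) auto
    show "AE x in lborel. (\<lambda>n. q n x) \<longlonglongrightarrow> f' x"
    proof (rule AE_I2)
      fix x
      have "((\<lambda>t. (f (x + t *\<^sub>R a) - f x) / t) \<longlongrightarrow> f' x) (at 0)"
        using deriv unfolding has_dir_deriv_def has_field_derivative_iff by auto
      moreover have "filterlim h (at 0) sequentially"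
        using h_lim h_pos by (auto simp: filterlim_at less_imp_neq[symmetric])
      ultimately show "(\<lambda>n. q n x) \<longlonglongrightarrow> f' x"
        unfolding q_def by (rule filterlim_compose)
    qed
  qed (use int_q bound in auto)
  then show ?thesis
    unfolding q0 using LIMSEQ_unique tendsto_const by blast
qed

lemma has_dir_deriv_partial:
  assumes "\<And>x. f differentiable (at x)"
  shows "has_dir_deriv f (axis i 1) (partial i f)"
  unfolding has_dir_deriv_def
proof
  fix x
  have "(f has_derivative frechet_derivative f (at x)) (at (x + 0 *\<^sub>R axis i 1))"
    using assms[of x] by (simp add: frechet_derivative_works)
  moreover have "((\<lambda>t::real. x + t *\<^sub>R axis i 1) has_derivative (\<lambda>t. t *\<^sub>R axis i 1)) (at 0)"
    by (auto intro!: derivative_eq_intros)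
  ultimately have "((\<lambda>t. f (x + t *\<^sub>R axis i 1)) has_derivative
      (\<lambda>t. frechet_derivative f (at x) (t *\<^sub>R axis i 1))) (at 0)"
    by (rule has_derivative_compose[rotated])
  moreover have "frechet_derivative f (at x) (t *\<^sub>R axis i 1) = t * partial i f x" for t
    using linear_frechet_derivative[OF assms[of x]]
    by (simp add: partial_def linear_cmul)
  ultimately show "((\<lambda>t. f (x + t *\<^sub>R axis i 1)) has_real_derivative partial i f x) (at 0)"
    unfolding has_field_derivative_def by (simp add: mult.commute[of _ "partial i f x"])
qed

subsection \<open>Continuously differentiable functions\<close>

text \<open>The class is meant to include the pressure, which need not be smooth where the density
  vanishes. It is closed under sums and products and suffices for integration by parts.\<close>

definition C1 :: "(real^'n::finite \<Rightarrow> real) \<Rightarrow> bool" where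
  "C1 f \<longleftrightarrow> (\<forall>x. f differentiable (at x)) \<and> (\<forall>i. continuous_on UNIV (partial i f))"

lemma C1_differentiable: "C1 f \<Longrightarrow> f differentiable (at x)"
  by (simp add: C1_def)

lemma C1_continuous_partial: "C1 f \<Longrightarrow> continuous_on UNIV (partial i f)"
  by (simp add: C1_def)

lemma C1_continuous: "C1 f \<Longrightarrow> continuous_on UNIV f"
  by (simp add: C1_def differentiable_at_withinI differentiable_imp_continuous_on
      differentiable_on_def)

lemma partial_eqI: "(f has_derivative D) (at x) \<Longrightarrow> partial i f x = D (axis i 1)"
  unfolding partial_def using frechet_derivative_at by metis

lemma has_derivative_C1: "C1 f \<Longrightarrow> (f has_derivative frechet_derivative f (at x)) (at x)"
  using C1_differentiable frechet_derivative_works by blast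

lemma partial_const: "partial i (\<lambda>y. c) x = 0"
  by (simp add: partial_def)

lemma partial_add:
  assumes "C1 f" "C1 g"
  shows "partial i (\<lambda>y. f y + g y) x = partial i f x + partial i g x"
  by (rule partial_eqI[OF has_derivative_add[OF assms[THEN has_derivative_C1]],
        folded partial_def])

lemma partial_diff:
  assumes "C1 f" "C1 g"
  shows "partial i (\<lambda>y. f y - g y) x = partial i f x - partial i g x"
  by (rule partial_eqI[OF has_derivative_diff[OF assms[THEN has_derivative_C1]],
        folded partial_def])

lemma partial_minus:
  assumes "C1 f"
  shows "partial i (\<lambda>y. - f y) x = - partial i f x"
  by (rule partial_eqI[OF has_derivative_minus[OF assms[THEN has_derivative_C1]],
        folded partial_def])

lemma partial_mult:
  assumes "C1 f" "C1 g"
  shows "partial i (\<lambda>y. f y * g y) x = f x * partial i g x + partial i f x * g x"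
  by (rule partial_eqI[OF has_derivative_mult[OF assms[THEN has_derivative_C1]],
        folded partial_def])

lemma partial_cmult:
  assumes "C1 f"
  shows "partial i (\<lambda>y. c * f y) x = c * partial i f x"
  by (rule partial_eqI[OF has_derivative_mult_right[OF assms[THEN has_derivative_C1]],
        folded partial_def])

lemma partial_sum:
  assumes "\<And>j. j \<in> S \<Longrightarrow> C1 (f j)"
  shows "partial i (\<lambda>y. \<Sum>j\<in>S. f j y) x = (\<Sum>j\<in>S. partial i (f j) x)"
  by (rule partial_eqI[OF has_derivative_sum[OF assms[THEN has_derivative_C1]],
        folded partial_def])

text \<open>Continuity is asked of a given formula \<open>D\<close> for the partial derivatives. For
  the pressure this formula will come from the momentum equation.\<close>

lemma C1I:
  assumes "\<And>x. f differentiable (at x)" "\<And>i x. partial i f x = D i x"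
    "\<And>i. continuous_on UNIV (D i)"
  shows "C1 f"
proof -
  have "partial i f = D i" for i
    by (rule ext) (rule assms(2))
  then show ?thesis
    using assms by (simp add: C1_def)
qed

lemma C1_const: "C1 (\<lambda>y. c)"
  by (rule C1I[OF _ partial_const]) simp_all

lemma C1_add: "C1 f \<Longrightarrow> C1 g \<Longrightarrow> C1 (\<lambda>y. f y + g y)"
  by (rule C1I[OF _ partial_add])
    (simp_all add: C1_differentiable C1_continuous_partial continuous_intros)

lemma C1_diff: "C1 f \<Longrightarrow> C1 g \<Longrightarrow> C1 (\<lambda>y. f y - g y)"
  by (rule C1I[OF _ partial_diff])
    (simp_all add: C1_differentiable C1_continuous_partial continuous_intros)

lemma C1_minus: "C1 f \<Longrightarrow> C1 (\<lambda>y. - f y)"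
  by (rule C1I[OF _ partial_minus])
    (simp_all add: C1_differentiable C1_continuous_partial continuous_intros)

lemma C1_mult: "C1 f \<Longrightarrow> C1 g \<Longrightarrow> C1 (\<lambda>y. f y * g y)"
  by (rule C1I[OF _ partial_mult])
    (simp_all add: C1_differentiable C1_continuous_partial C1_continuous continuous_intros)

lemma C1_sum: "finite S \<Longrightarrow> (\<And>j. j \<in> S \<Longrightarrow> C1 (f j)) \<Longrightarrow> C1 (\<lambda>y. \<Sum>j\<in>S. f j y)"
  by (induction S rule: finite_induct) (simp_all add: C1_const C1_add)

lemmas C1_intros = C1_const C1_add C1_diff C1_minus C1_mult C1_sum

section \<open>Smooth functions and mixed partial derivatives\<close>

lemma smooth_partial: "smooth f \<Longrightarrow> smooth (partial i f)"
proof -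
  \<comment> \<open>The head of the list is the outermost derivative, so the derivative taken first
    stands at the end.\<close>
  have "iter_partial (is @ [i]) f = iter_partial is (partial i f)" for "is"
    by (induction "is") simp_all
  then show "smooth f \<Longrightarrow> smooth (partial i f)"
    unfolding smooth_def by metis
qed

lemma smooth_imp_C1:
  assumes "smooth f"
  shows "C1 f"
proof -
  have diff: "g differentiable (at x)" if "smooth g" for g :: "real^'n \<Rightarrow> real" and x
    using that unfolding smooth_def by (metis iter_partial.simps(1))
  have "continuous_on UNIV (partial i f)" for i
    using diff[OF smooth_partial[OF assms]]
    by (simp add: differentiable_at_withinI differentiable_imp_continuous_on differentiable_on_def)
  with diff[OF assms] show ?thesis by (simp add: C1_def)
qed

lemma partial_commute:
  assumes "smooth f"
  shows "partial i (partial j f) = partial j (partial i f)"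
proof
  fix x
  note s = smooth_partial[OF assms]
  show "partial i (partial j f) x = partial j (partial i f) x"
    by (rule dir_deriv_commute[of f "axis i 1" "partial i f" "axis j 1" _ "partial j f"])
      (use assms s smooth_partial[OF s] in \<open>auto intro!: has_dir_deriv_partial
        C1_differentiable smooth_imp_C1 differentiable_imp_continuous_within\<close>)
qed

lemma partial_zero_imp_constant:
  assumes diff: "\<And>x. f differentiable (at x)" and zero: "\<And>i x. partial i f x = 0"
  shows "\<exists>c. \<forall>x. f x = c"
proof -
  have "(f has_derivative (\<lambda>h. 0)) (at x)" for x
  proof -
    have "frechet_derivative f (at x) = (\<lambda>h. 0)"
      using zero[of _ x] linear_frechet_derivative[OF diff]
      unfolding partial_def by (intro linear_eq_stdbasis linear_zero) (auto simp: Basis_vec_def)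
    then show ?thesis using diff[of x] by (simp add: frechet_derivative_works)
  qed
  then show ?thesis
    using has_derivative_zero_constant[of UNIV f] by auto
qed

subsection \<open>Vanishing of the energy density at the critical exponent\<close>

text \<open>Squaring removes the kink of the positive part: the difference quotient at 0 is bounded
  by \<open>|y|\<close>. This is why the cutoff is used squared.\<close>

lemma DERIV_max_0_square:
  "((\<lambda>s::real. (max 0 s)\<^sup>2) has_real_derivative 2 * max 0 s) (at s)"
proof -
  consider "s > 0" | "s < 0" | "s = 0" by linarith
  then show ?thesis
  proof cases
    case 1
    have "((\<lambda>s::real. s\<^sup>2) has_real_derivative 2 * max 0 s) (at s)"
      using 1 by (auto intro!: derivative_eq_intros)
    then show ?thesis
      by (rule has_field_derivative_transform_within_open[of _ _ _ "{0<..}"]) (use 1 in auto)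
  next
    case 2
    have "((\<lambda>s::real. 0) has_real_derivative 2 * max 0 s) (at s)"
      using 2 by (auto intro!: derivative_eq_intros)
    then show ?thesis
      by (rule has_field_derivative_transform_within_open[of _ _ _ "{..<0}"]) (use 2 in auto)
  next
    case 3
    have "((\<lambda>y::real. (max 0 y)\<^sup>2 / y) \<longlongrightarrow> 0) (at 0)"
    proof (rule Lim_null_comparison)
      have "norm ((max 0 y)\<^sup>2 / y) \<le> \<bar>y\<bar>" for y :: real
        by (cases "y \<le> 0") (auto simp: power2_eq_square max_def)
      then show "\<forall>\<^sub>F y in at 0. norm ((max 0 y)\<^sup>2 / y) \<le> \<bar>y::real\<bar>"
        by simp
      show "((\<lambda>y::real. \<bar>y\<bar>) \<longlongrightarrow> 0) (at 0)"
        by (auto intro!: tendsto_eq_intros)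
    qed
    then show ?thesis
      unfolding has_field_derivative_iff using 3 by simp
  qed
qed

section \<open>Quadratic cutoff, energy identity and truncation estimates\<close>

definition bump :: "real \<Rightarrow> 'a::real_inner \<Rightarrow> real" where
  "bump R x = max 0 (1 - (x \<bullet> x) / R\<^sup>2)"

lemma continuous_on_bump [continuous_intros]: "continuous_on S (bump R)"
  unfolding bump_def divide_inverse by (intro continuous_intros)

lemma bump_bounds: "0 \<le> bump R x" "bump R x \<le> 1"
  by (auto simp: bump_def)

lemma bump_eq_0:
  assumes "0 < R" "R \<le> norm x"
  shows "bump R x = 0"
proof -
  have "R\<^sup>2 \<le> x \<bullet> x"
    using assms by (simp add: power_mono flip: power2_norm_eq_inner)
  then show ?thesis using assms by (simp add: bump_def max_def field_simps)
qed

text \<open>One factor \<open>bump R x\<close> survives differentiation; it later pairs with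
  \<open>sqrt (E x)\<close> when Young's inequality absorbs the gradient term. Division by zero
  being 0 covers \<open>R = 0\<close>.\<close>

lemma has_dir_deriv_bump_square:
  "has_dir_deriv (\<lambda>x. (bump R x)\<^sup>2) a (\<lambda>x. - 4 * bump R x * (x \<bullet> a) / R\<^sup>2)"
  unfolding has_dir_deriv_def
proof
  fix x :: 'a
  let ?g = "\<lambda>t. 1 - ((x + t *\<^sub>R a) \<bullet> (x + t *\<^sub>R a)) / R\<^sup>2"
  have "?g = (\<lambda>t. 1 - (x \<bullet> x + 2 * t * (x \<bullet> a) + t\<^sup>2 * (a \<bullet> a)) / R\<^sup>2)"
    by (simp add: fun_eq_iff inner_simps inner_commute power2_eq_square algebra_simps)
  moreover have "((\<lambda>t. 1 - (x \<bullet> x + 2 * t * (x \<bullet> a) + t\<^sup>2 * (a \<bullet> a)) / R\<^sup>2)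
      has_real_derivative - 2 * (x \<bullet> a) / R\<^sup>2) (at 0)"
    unfolding divide_inverse by (auto intro!: derivative_eq_intros)
  ultimately have g: "(?g has_real_derivative - 2 * (x \<bullet> a) / R\<^sup>2) (at 0)"
    by simp
  show "((\<lambda>t. (bump R (x + t *\<^sub>R a))\<^sup>2) has_real_derivative
      - 4 * bump R x * (x \<bullet> a) / R\<^sup>2) (at 0)"
    using DERIV_chain2[OF DERIV_max_0_square g] by (simp add: bump_def mult.assoc)
qed

text \<open>This is \<open>div G = - E\<close> tested with the squared cutoff: the product of that
  cutoff with \<open>G\<close> has compact support, so its divergence integrates to zero.\<close>

lemma energy_cutoff_identity:
  fixes G :: "real^'n::finite \<Rightarrow> real^'n"
  assumes G: "\<And>i. C1 (\<lambda>y. G y $ i)"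
    and div: "\<And>x. (\<Sum>i\<in>UNIV. partial i (\<lambda>y. G y $ i) x) = - E x"
    and "0 < R"
  shows "integrable lborel (\<lambda>x. (bump R x)\<^sup>2 * E x)"
    and "integrable lborel (\<lambda>x. - 4 * bump R x * (x \<bullet> G x) / R\<^sup>2)"
    and "(\<integral>x. (bump R x)\<^sup>2 * E x \<partial>lborel) = (\<integral>x. - 4 * bump R x * (x \<bullet> G x) / R\<^sup>2 \<partial>lborel)"
proof -
  have contG: "continuous_on UNIV (\<lambda>y. G y $ i)" for i
    using G by (rule C1_continuous)
  have contE: "continuous_on UNIV E"
  proof -
    have "continuous_on UNIV (\<lambda>x. - (\<Sum>i\<in>UNIV. partial i (\<lambda>y. G y $ i) x))"
      by (intro continuous_intros C1_continuous_partial G)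
    then show ?thesis by (simp add: div)
  qed
  have contxG: "continuous_on UNIV (\<lambda>x. x \<bullet> G x)"
    unfolding inner_vec_def inner_real_def by (intro continuous_intros contG)
  have z: "bump R x = 0" if "R < norm x" for x :: "real^'n"
    using bump_eq_0[of R x] that \<open>0 < R\<close> by simp
  show i1: "integrable lborel (\<lambda>x. (bump R x)\<^sup>2 * E x)"
    by (rule integrable_compact_support[of _ R]) (auto intro!: continuous_intros contE simp: z)
  show i2: "integrable lborel (\<lambda>x. - 4 * bump R x * (x \<bullet> G x) / R\<^sup>2)"
    unfolding divide_inverse
    by (rule integrable_compact_support[of _ R]) (auto intro!: continuous_intros contxG simp: z)
  \<comment> \<open>By the product rule, \<open>?F i\<close> is the derivative along axis
    \<open>i\<close> of component \<open>i\<close> of the localized flux.\<close>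
  let ?F = "\<lambda>i x. (- 4 * bump R x * (x \<bullet> axis i 1) / R\<^sup>2) * G x $ i
      + (bump R x)\<^sup>2 * partial i (\<lambda>y. G y $ i) x"
  have contF: "continuous_on UNIV (?F i)" for i
    unfolding divide_inverse by (intro continuous_intros contG C1_continuous_partial G)
  have intF: "integrable lborel (?F i)" for i
    by (rule integrable_compact_support[of _ R, OF contF]) (simp add: z)
  have "(\<integral>x. ?F i x \<partial>lborel) = 0" for i
  proof (rule integral_dir_deriv_eq_0[of "\<lambda>x. (bump R x)\<^sup>2 * G x $ i" "axis i 1" _ R])
    show "has_dir_deriv (\<lambda>x. (bump R x)\<^sup>2 * G x $ i) (axis i 1) (?F i)"
      unfolding has_dir_deriv_def
    proof
      fix x :: "real^'n"
      have *: "((\<lambda>t. (bump R (x + t *\<^sub>R axis i 1))\<^sup>2) has_real_derivative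
          - 4 * bump R x * (x \<bullet> axis i 1) / R\<^sup>2) (at 0)"
        "((\<lambda>t. G (x + t *\<^sub>R axis i 1) $ i) has_real_derivative
          partial i (\<lambda>y. G y $ i) x) (at 0)"
        using has_dir_deriv_bump_square has_dir_deriv_partial[OF C1_differentiable[OF G]]
        unfolding has_dir_deriv_def by blast+
      show "((\<lambda>t. (bump R (x + t *\<^sub>R axis i 1))\<^sup>2 * G (x + t *\<^sub>R axis i 1) $ i)
          has_real_derivative ?F i x) (at 0)"
        using DERIV_mult[OF *] by (simp add: algebra_simps)
    qed
    show "continuous_on UNIV (\<lambda>x. (bump R x)\<^sup>2 * G x $ i)"
      by (intro continuous_intros contG)
    show "continuous_on UNIV (?F i)"
      by (rule contF)
  qed (auto simp: z)
  then have "(\<integral>x. (\<Sum>i\<in>UNIV. ?F i x) \<partial>lborel) = 0"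
    by (subst Bochner_Integration.integral_sum) (simp_all only: intF sum.neutral_const)
  moreover have "(\<Sum>i\<in>UNIV. ?F i x) = - 4 * bump R x * (x \<bullet> G x) / R\<^sup>2 - (bump R x)\<^sup>2 * E x" for x
  proof -
    have "(\<Sum>i\<in>UNIV. ?F i x) = (\<Sum>i\<in>UNIV. (- 4 * bump R x / R\<^sup>2) * (x $ i * G x $ i))
        + (\<Sum>i\<in>UNIV. (bump R x)\<^sup>2 * partial i (\<lambda>y. G y $ i) x)"
      by (simp add: sum.distrib[symmetric] inner_axis mult_ac)
    also have "\<dots> = (- 4 * bump R x / R\<^sup>2) * (x \<bullet> G x) + (bump R x)\<^sup>2 * (- E x)"
      unfolding sum_distrib_left[symmetric] div by (simp add: inner_vec_def)
    finally show ?thesis by simp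
  qed
  ultimately have "(\<integral>x. - 4 * bump R x * (x \<bullet> G x) / R\<^sup>2 - (bump R x)\<^sup>2 * E x \<partial>lborel) = 0"
    by simp
  then show "(\<integral>x. (bump R x)\<^sup>2 * E x \<partial>lborel) = (\<integral>x. - 4 * bump R x * (x \<bullet> G x) / R\<^sup>2 \<partial>lborel)"
    using i1 i2 by (subst (asm) Bochner_Integration.integral_diff) auto
qed

text \<open>If \<open>u > t\<close>, then \<open>(u / t) powr (p - 1)\<close> is at least 1, so the
  second summand dominates \<open>u\<close>; otherwise the first one does.\<close>

lemma le_truncation:
  fixes u t p :: real
  assumes "0 \<le> u" "0 < t" "1 \<le> p"
  shows "u \<le> t + t powr (1 - p) * u powr p"
proof (cases "u \<le> t")
  case True
  then show ?thesis using assms by (simp add: add_increasing2)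
next
  case False
  then have "u = u powr (1 - p) * u powr p"
    using assms by (simp add: powr_add[symmetric])
  also have "\<dots> \<le> t powr (1 - p) * u powr p"
    using assms False by (intro mult_right_mono powr_mono2') auto
  finally show ?thesis using assms by linarith
qed

text \<open>In the application \<open>b\<close> is the cutoff, \<open>k = norm x / R^2\<close> and
  \<open>s = sqrt (E x)\<close>. Young's inequality splits off half of \<open>b^2 * s^2\<close>; its
  remainder, quadratic in \<open>u\<close>, lies below \<open>u + u ^ 3\<close> by the inequality of
  means.\<close>

lemma cutoff_term_bound:
  fixes k s u C b :: real
  assumes "0 \<le> k" "k \<le> 1" "0 \<le> s" "0 \<le> u" "0 \<le> C" "0 \<le> b" "b \<le> 1"
  shows "4 * b * k * (C * (s * u + u + u ^ 3)) \<le> b\<^sup>2 * s\<^sup>2 / 2 + (8 * C\<^sup>2 + 4 * C) * (k * (u + u ^ 3))"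
proof -
  have "0 \<le> (b * s - 4 * k * C * u)\<^sup>2" by simp
  then have 1: "4 * b * k * (C * (s * u)) \<le> b\<^sup>2 * s\<^sup>2 / 2 + 8 * C\<^sup>2 * (k\<^sup>2 * u\<^sup>2)"
    by (simp add: power2_eq_square algebra_simps)
  have "0 \<le> u * (1 - u)\<^sup>2" using assms by simp
  then have "u\<^sup>2 * 2 \<le> u + u ^ 3" by (simp add: power2_eq_square power3_eq_cube algebra_simps)
  then have "u\<^sup>2 \<le> u + u ^ 3" using zero_le_power2[of u] by linarith
  moreover have "k\<^sup>2 \<le> k" using assms by (simp add: power2_eq_square mult_left_le)
  ultimately have "k\<^sup>2 * u\<^sup>2 \<le> k * (u + u ^ 3)"
    using assms by (intro mult_mono) auto
  then have 2: "8 * C\<^sup>2 * (k\<^sup>2 * u\<^sup>2) \<le> 8 * C\<^sup>2 * (k * (u + u ^ 3))"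
    by (intro mult_left_mono) auto
  have "b * (4 * k * C * (u + u ^ 3)) \<le> 4 * k * C * (u + u ^ 3)"
    using assms by (intro mult_left_le_one_le) auto
  with 1 2 show ?thesis by (simp add: algebra_simps)
qed

text \<open>Both exponents enter only through truncation at the level \<open>t = \<delta> / R ^ (d - 1)\<close>, for which
  \<open>t powr (1 - p) = \<delta> powr (1 - p) * R\<close> when \<open>p = d / (d - 1)\<close>: this is where the critical
  exponent is used.\<close>

lemma cutoff_term_truncated:
  fixes d :: nat
  assumes d: "2 \<le> d" and p: "p = real d / (real d - 1)"
    and "1 \<le> R" "0 \<le> r" "r \<le> R" "0 \<le> u" "0 < \<delta>"
  shows "r / R\<^sup>2 * (u + u ^ 3)
    \<le> 2 * \<delta> / R ^ d + \<delta> powr (1 - p) * (r / R * (u powr p + u powr (3 * p)))"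
proof -
  define t where "t = \<delta> / R ^ (d - 1)"
  have t: "t > 0" using assms by (simp add: t_def)
  have p1: "1 \<le> p" using d by (simp add: p)
  have e: "1 - p = - (1 / (real d - 1))" using d by (simp add: p field_simps)
  have "(R ^ (d - 1)) powr (1 - p) = R powr ((real d - 1) * (1 - p))"
    using assms by (subst powr_realpow[symmetric]) (simp_all add: powr_powr of_nat_diff)
  also have "(real d - 1) * (1 - p) = - 1" using d by (simp add: e)
  finally have Rp: "(R ^ (d - 1)) powr (1 - p) = 1 / R"
    using assms by (simp add: powr_minus_divide)
  have tp: "t powr (1 - p) = \<delta> powr (1 - p) * R"
    unfolding t_def using assms Rp by (subst powr_divide) auto
  have "u ^ 3 \<le> t + t powr (1 - p) * (u ^ 3) powr p"
    using assms t p1 by (intro le_truncation) auto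
  moreover have "(u ^ 3) powr p = u powr (3 * p)"
    using assms powr_powr[of u 3 p] by (cases "u = 0") simp_all
  moreover have "u \<le> t + t powr (1 - p) * u powr p"
    using assms t p1 by (intro le_truncation) auto
  ultimately have "u + u ^ 3 \<le> 2 * t + \<delta> powr (1 - p) * R * (u powr p + u powr (3 * p))"
    by (simp add: tp algebra_simps)
  then have "r / R\<^sup>2 * (u + u ^ 3)
      \<le> r / R\<^sup>2 * (2 * t + \<delta> powr (1 - p) * R * (u powr p + u powr (3 * p)))"
    using assms by (intro mult_left_mono) auto
  also have "\<dots> = r / R\<^sup>2 * (2 * t) + \<delta> powr (1 - p) * (r / R * (u powr p + u powr (3 * p)))"
    using assms by (simp add: power2_eq_square field_simps)
  \<comment> \<open>Here \<open>r\<close> is at most \<open>R\<close>. The resulting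
    \<open>2 * \<delta> / R ^ d\<close> integrates over the ball of radius \<open>R\<close> to a
    multiple of \<open>\<delta>\<close> that does not depend on \<open>R\<close>.\<close>
  also have "r / R\<^sup>2 * (2 * t) \<le> 1 / R * (2 * t)"
    using assms t by (intro mult_right_mono) (auto simp: power2_eq_square field_simps)
  also have "1 / R * (2 * t) = 2 * \<delta> / R ^ d"
    using d assms by (cases d) (auto simp: t_def field_simps)
  finally show ?thesis by simp
qed

text \<open>On the ball the weight is at most 1, while at each fixed \<open>x\<close> it tends to 0
  as the radius grows; dominated convergence applies with majorant
  \<open>norm (h x)\<close>.\<close>

lemma weighted_integral_tendsto_0:
  fixes h :: "'a::euclidean_space \<Rightarrow> real"
  assumes "integrable lborel h"
  shows "integrable lborel (\<lambda>x. indicator (cball 0 R) x * (norm x / R * h x))"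
    and "(\<lambda>n. \<integral>x. indicator (cball 0 (real (Suc n))) x * (norm x / real (Suc n) * h x) \<partial>lborel)
      \<longlonglongrightarrow> 0"
proof -
  have h: "h \<in> borel_measurable lborel"
    using assms by auto
  have m: "(\<lambda>x. indicator (cball 0 R) x * (norm x / R * h x)) \<in> borel_measurable lborel" for R
    by (intro borel_measurable_times borel_measurable_indicator borel_measurable_divide h) auto
  have bd: "norm (indicator (cball 0 R) x * (norm x / R * h x)) \<le> norm (h x)" for x and R
  proof (cases "norm x \<le> R \<and> R \<noteq> 0")
    case True
    then have "norm x / R * \<bar>h x\<bar> \<le> 1 * \<bar>h x\<bar>"
      using order_trans[OF norm_ge_zero, of x R]
      by (intro mult_right_mono) (auto simp: divide_le_eq_1)
    then show ?thesis
      using True order_trans[OF norm_ge_zero, of x R] by (simp add: abs_mult)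
  qed (auto simp: indicator_def)
  show "integrable lborel (\<lambda>x. indicator (cball 0 R) x * (norm x / R * h x))"
    by (rule Bochner_Integration.integrable_bound[OF assms m]) (use bd in auto)
  have "(\<lambda>n. \<integral>x. indicator (cball 0 (real (Suc n))) x * (norm x / real (Suc n) * h x) \<partial>lborel)
      \<longlonglongrightarrow> (\<integral>x. 0 \<partial>(lborel :: 'a measure))"
  proof (rule integral_dominated_convergence[where w = "\<lambda>x. norm (h x)"])
    show "AE x in lborel. (\<lambda>n. indicator (cball 0 (real (Suc n))) x * (norm x / real (Suc n) * h x))
        \<longlonglongrightarrow> 0"
    proof (rule AE_I2)
      fix x :: 'a
      have "(\<lambda>n. norm x * (inverse (real (Suc n)) * \<bar>h x\<bar>)) \<longlonglongrightarrow> norm x * (0 * \<bar>h x\<bar>)"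
        by (intro tendsto_intros LIMSEQ_inverse_real_of_nat)
      then have lim: "(\<lambda>n. norm x * (inverse (real (Suc n)) * \<bar>h x\<bar>)) \<longlonglongrightarrow> 0"
        by simp
      show "(\<lambda>n. indicator (cball 0 (real (Suc n))) x * (norm x / real (Suc n) * h x)) \<longlonglongrightarrow> 0"
        by (rule Lim_null_comparison[OF _ lim])
          (auto simp: indicator_def abs_mult divide_inverse mult_ac)
    qed
    show "AE x in lborel. norm (indicator (cball 0 (real (Suc n))) x * (norm x / real (Suc n) * h x))
        \<le> norm (h x)" for n
      by (rule AE_I2) (rule bd)
  qed (use m assms in auto)
  then show "(\<lambda>n. \<integral>x. indicator (cball 0 (real (Suc n))) x * (norm x / real (Suc n) * h x) \<partial>lborel)
      \<longlonglongrightarrow> 0"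
    by simp
qed

text \<open>Half of the weighted energy is absorbed on the left. Truncation splits the rest into a
  volume term controlled by \<open>\<delta>\<close> alone and a weighted integral that vanishes as
  \<open>R\<close> grows.\<close>

lemma cutoff_energy_bound:
  fixes G :: "real^'n::finite \<Rightarrow> real^'n" and u E :: "real^'n \<Rightarrow> real"
  assumes dim: "2 \<le> CARD('n)" and p: "p = real CARD('n) / (real CARD('n) - 1)"
    and G: "\<And>i. C1 (\<lambda>y. G y $ i)"
    and div: "\<And>x. (\<Sum>i\<in>UNIV. partial i (\<lambda>y. G y $ i) x) = - E x"
    and E: "\<And>x. 0 \<le> E x" and u: "\<And>x. 0 \<le> u x" and C: "0 \<le> C"
    and bound: "\<And>x. norm (G x) \<le> C * (sqrt (E x) * u x + u x + u x ^ 3)"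
    and int: "integrable lborel (\<lambda>x. u x powr p)" "integrable lborel (\<lambda>x. u x powr (3 * p))"
    and R: "1 \<le> R" and \<delta>: "0 < \<delta>"
  shows "(\<integral>x. (bump R x)\<^sup>2 * E x \<partial>lborel) / 2
    \<le> (8 * C\<^sup>2 + 4 * C) * (2 * \<delta> * unit_ball_vol CARD('n) + \<delta> powr (1 - p) *
      (\<integral>x. indicator (cball 0 R) x * (norm x / R * (u x powr p + u x powr (3 * p))) \<partial>lborel))"
proof -
  define K where "K = 8 * C\<^sup>2 + 4 * C"
  define h where "h = (\<lambda>x. u x powr p + u x powr (3 * p))"
  have K: "K \<ge> 0" using C by (simp add: K_def)
  have R0: "0 < R" using R by simp
  have int_h: "integrable lborel h" using int by (simp add: h_def)
  note eci = energy_cutoff_identity[OF G div R0]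
  let ?D = "\<lambda>x. - 4 * bump R x * (x \<bullet> G x) / R\<^sup>2"
  let ?M = "\<lambda>x. K * (2 * \<delta> / R ^ CARD('n)) * indicator (cball 0 R) x
      + K * \<delta> powr (1 - p) * (indicator (cball 0 R) x * (norm x / R * h x))"
  have intB: "integrable lborel (indicator (cball 0 R) :: real^'n \<Rightarrow> real)"
    by (intro integrable_real_indicator) (simp_all add: emeasure_bounded_finite[unfolded infinity_ennreal_def])
  note intM = integrable_mult_right[OF intB, of "K * (2 * \<delta> / R ^ CARD('n))"]
    integrable_mult_right[OF weighted_integral_tendsto_0(1)[OF int_h, of R], of "K * \<delta> powr (1 - p)"]
  \<comment> \<open>The energy part of Young's inequality is subtracted on the left, so the majorant
    \<open>?M\<close> no longer contains \<open>E\<close>.\<close>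
  have pw: "?D x - (bump R x)\<^sup>2 * E x / 2 \<le> ?M x" for x
  proof (cases "norm x \<le> R")
    case True
    define k where "k = norm x / R\<^sup>2"
    have k0: "0 \<le> k" by (simp add: k_def)
    \<comment> \<open>The assumption that \<open>R\<close> is at least 1 is what makes
      \<open>k\<close> at most 1.\<close>
    have "norm x \<le> R * R" using True R mult_mono[of 1 R R R] by linarith
    then have k1: "k \<le> 1" using R by (simp add: k_def power2_eq_square)
    have "\<bar>x \<bullet> G x\<bar> \<le> norm x * norm (G x)" by (rule Cauchy_Schwarz_ineq2)
    also have "\<dots> \<le> norm x * (C * (sqrt (E x) * u x + u x + u x ^ 3))"
      using bound by (intro mult_left_mono) auto
    finally have "- (x \<bullet> G x) \<le> norm x * (C * (sqrt (E x) * u x + u x + u x ^ 3))" by linarith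
    then have "(4 * bump R x / R\<^sup>2) * - (x \<bullet> G x)
        \<le> (4 * bump R x / R\<^sup>2) * (norm x * (C * (sqrt (E x) * u x + u x + u x ^ 3)))"
      using bump_bounds[of R x] by (intro mult_left_mono) auto
    then have "?D x \<le> 4 * bump R x * k * (C * (sqrt (E x) * u x + u x + u x ^ 3))"
      by (simp add: k_def mult_ac)
    also have "\<dots> \<le> (bump R x)\<^sup>2 * (sqrt (E x))\<^sup>2 / 2 + K * (k * (u x + u x ^ 3))"
      unfolding K_def using E u C bump_bounds[of R x] k0 k1 by (intro cutoff_term_bound) auto
    also have "(sqrt (E x))\<^sup>2 = E x" using E by simp
    finally have "?D x - (bump R x)\<^sup>2 * E x / 2 \<le> K * (k * (u x + u x ^ 3))" by simp
    also have "\<dots> \<le> K * (2 * \<delta> / R ^ CARD('n) + \<delta> powr (1 - p) * (norm x / R * h x))"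
      unfolding k_def h_def using dim p R True u \<delta> K
      by (intro mult_left_mono cutoff_term_truncated) auto
    finally show ?thesis using True by (simp add: algebra_simps)
  next
    case False
    then show ?thesis using bump_eq_0[OF R0, of x] by simp
  qed
  have "(\<integral>x. (bump R x)\<^sup>2 * E x \<partial>lborel) / 2
      = (\<integral>x. ?D x \<partial>lborel) - (\<integral>x. (bump R x)\<^sup>2 * E x \<partial>lborel) / 2"
    unfolding eci(3) by simp
  also have "\<dots> = (\<integral>x. ?D x - (bump R x)\<^sup>2 * E x / 2 \<partial>lborel)"
    using eci(1,2) by (subst Bochner_Integration.integral_diff) auto
  also have "\<dots> \<le> (\<integral>x. ?M x \<partial>lborel)"
    using eci(1,2) pw by (intro integral_mono Bochner_Integration.integrable_add intM) auto
  also have "\<dots> = K * (2 * \<delta> / R ^ CARD('n)) * measure lborel (cball 0 R :: (real^'n) set)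
      + K * \<delta> powr (1 - p) * (\<integral>x. indicator (cball 0 R) x * (norm x / R * h x) \<partial>lborel)"
    unfolding Bochner_Integration.integral_add[OF intM] integral_mult_right_zero by simp
  also have "measure lborel (cball 0 R :: (real^'n) set) = unit_ball_vol CARD('n) * R ^ CARD('n)"
    using content_cball[of R "0 :: real^'n"] R by simp
  also have "K * (2 * \<delta> / R ^ CARD('n)) * (unit_ball_vol CARD('n) * R ^ CARD('n))
      = K * (2 * \<delta> * unit_ball_vol CARD('n))"
    using R by simp
  finally show ?thesis by (simp add: K_def h_def algebra_simps)
qed

text \<open>If \<open>E\<close> were positive somewhere, the weighted energy would exceed a fixed
  \<open>c\<close> for all large \<open>R\<close>. Against this, \<open>\<delta>\<close> is fixed
  first to make the volume term small, and then \<open>R\<close> is taken large; the possibly huge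
  factor \<open>\<delta> powr (1 - p)\<close> is constant by then.\<close>

theorem critical_caccioppoli_vanishing:
  fixes G :: "real^'n::finite \<Rightarrow> real^'n" and u E :: "real^'n \<Rightarrow> real"
  assumes dim: "2 \<le> CARD('n)" and p: "p = real CARD('n) / (real CARD('n) - 1)"
    and G: "\<And>i. C1 (\<lambda>y. G y $ i)"
    and div: "\<And>x. (\<Sum>i\<in>UNIV. partial i (\<lambda>y. G y $ i) x) = - E x"
    and E: "\<And>x. 0 \<le> E x" and u: "\<And>x. 0 \<le> u x" and C: "0 \<le> C"
    and bound: "\<And>x. norm (G x) \<le> C * (sqrt (E x) * u x + u x + u x ^ 3)"
    and int: "integrable lborel (\<lambda>x. u x powr p)" "integrable lborel (\<lambda>x. u x powr (3 * p))"
  shows "E x\<^sub>0 = 0"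
proof (rule ccontr)
  assume "E x\<^sub>0 \<noteq> 0"
  then have E0: "E x\<^sub>0 > 0" using E[of x\<^sub>0] by simp
  define K where "K = 8 * C\<^sup>2 + 4 * C"
  define V where "V = unit_ball_vol CARD('n)"
  define h where "h = (\<lambda>x. u x powr p + u x powr (3 * p))"
  have K: "K \<ge> 0" using C by (simp add: K_def)
  have V: "V \<ge> 0" by (simp add: V_def unit_ball_vol_nonneg)
  have contE: "continuous_on UNIV E"
  proof -
    have "continuous_on UNIV (\<lambda>x. - (\<Sum>i\<in>UNIV. partial i (\<lambda>y. G y $ i) x))"
      by (intro continuous_intros C1_continuous_partial G)
    then show ?thesis by (simp add: div)
  qed
  then obtain r0 where r0: "r0 > 0" "\<And>x. dist x x\<^sub>0 < r0 \<Longrightarrow> dist (E x) (E x\<^sub>0) < E x\<^sub>0 / 2"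
    using E0 half_gt_zero unfolding continuous_on_eq_continuous_at[OF open_UNIV]
      continuous_at_eps_delta by blast
  define r where "r = r0 / 2"
  have r: "r > 0" using r0 by (simp add: r_def)
  have Er: "E x \<ge> E x\<^sub>0 / 2" if "x \<in> cball x\<^sub>0 r" for x
    using r0(2)[of x] that r0(1) unfolding r_def dist_real_def
    by (auto simp: dist_commute abs_if split: if_splits)
  \<comment> \<open>On the small ball \<open>E\<close> is at least \<open>E x\<^sub>0 / 2\<close>,
    and for large \<open>R\<close> the squared cutoff is at least 1/2 there.\<close>
  define c where "c = E x\<^sub>0 / 4 * measure lborel (cball x\<^sub>0 r)"
  have c: "c > 0" unfolding c_def using E0 content_cball_pos[OF r, of x\<^sub>0] by simp
  have lower: "c \<le> (\<integral>x. (bump R x)\<^sup>2 * E x \<partial>lborel)" if R: "R \<ge> 2 * (norm x\<^sub>0 + r)" for R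
  proof -
    have R0: "0 < R" using R r by (smt (verit) norm_ge_zero)
    have intB: "integrable lborel (indicator (cball x\<^sub>0 r) :: real^'n \<Rightarrow> real)"
      by (intro integrable_real_indicator) (simp_all add: emeasure_bounded_finite[unfolded infinity_ennreal_def])
    have "c = (\<integral>x. E x\<^sub>0 / 4 * indicator (cball x\<^sub>0 r) x \<partial>lborel)"
      by (simp add: c_def)
    also have "\<dots> \<le> (\<integral>x. (bump R x)\<^sup>2 * E x \<partial>lborel)"
    proof (rule integral_mono)
      show "integrable lborel (\<lambda>x. E x\<^sub>0 / 4 * indicator (cball x\<^sub>0 r) x)"
        using intB by simp
      show "integrable lborel (\<lambda>x. (bump R x)\<^sup>2 * E x)"
        by (rule energy_cutoff_identity(1)[OF G div R0])
      fix x
      show "E x\<^sub>0 / 4 * indicator (cball x\<^sub>0 r) x \<le> (bump R x)\<^sup>2 * E x"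
      proof (cases "x \<in> cball x\<^sub>0 r")
        case True
        have "norm x \<le> norm x\<^sub>0 + r"
          using True norm_triangle_ineq2[of x x\<^sub>0] by (simp add: dist_norm norm_minus_commute)
        then have "2 * norm x \<le> R" by (intro order_trans[OF _ R]) simp
        then have "(2 * norm x)\<^sup>2 \<le> R\<^sup>2" by (intro power_mono) auto
        then have "4 * (x \<bullet> x) \<le> R\<^sup>2" by (simp add: power_mult_distrib power2_norm_eq_inner)
        then have "(x \<bullet> x) / R\<^sup>2 \<le> 1 / 4" using R0 by (simp add: field_simps)
        then have "3 / 4 \<le> bump R x" unfolding bump_def by (intro max.coboundedI2) linarith
        then have "(3 / 4)\<^sup>2 \<le> (bump R x)\<^sup>2" by (intro power_mono) auto
        then have "1 / 2 \<le> (bump R x)\<^sup>2" by (simp add: power2_eq_square)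
        then have "1 / 2 * (E x\<^sub>0 / 2) \<le> (bump R x)\<^sup>2 * E x"
          using Er[OF True] E0 by (intro mult_mono) auto
        then show ?thesis using True by simp
      qed (use E in simp)
    qed
    finally show ?thesis .
  qed
  \<comment> \<open>This makes the volume term \<open>c / 8\<close> times
    \<open>K * V / (K * V + 1)\<close>; the summand 1 allows \<open>K * V = 0\<close>.\<close>
  define \<delta> where "\<delta> = c / (16 * (K * V + 1))"
  have "K * V \<ge> 0" using K V by simp
  then have \<delta>: "\<delta> > 0" and \<delta>_small: "K * (2 * \<delta> * V) \<le> c / 8"
    using c by (auto simp: \<delta>_def field_simps)
  define J where "J = (\<lambda>R. \<integral>x. indicator (cball 0 R) x * (norm x / R * h x) \<partial>lborel)"
  have "(\<lambda>n. J (real (Suc n))) \<longlonglongrightarrow> 0"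
    unfolding J_def h_def using int by (intro weighted_integral_tendsto_0(2)) auto
  then have "(\<lambda>n. K * \<delta> powr (1 - p) * J (real (Suc n))) \<longlonglongrightarrow> K * \<delta> powr (1 - p) * 0"
    by (intro tendsto_intros)
  then have "\<forall>\<^sub>F n in sequentially. K * \<delta> powr (1 - p) * J (real (Suc n)) < c / 8"
    using c by (intro order_tendstoD(2)) auto
  moreover have "\<forall>\<^sub>F n in sequentially. 2 * (norm x\<^sub>0 + r) \<le> real n"
    by (rule eventually_sequentiallyI[of "nat \<lceil>2 * (norm x\<^sub>0 + r)\<rceil>"]) linarith
  ultimately have "\<forall>\<^sub>F n in sequentially. K * \<delta> powr (1 - p) * J (real (Suc n)) < c / 8 \<and>
      2 * (norm x\<^sub>0 + r) \<le> real n"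
    by eventually_elim simp
  then obtain n where n: "K * \<delta> powr (1 - p) * J (real (Suc n)) < c / 8"
    "2 * (norm x\<^sub>0 + r) \<le> real n"
    unfolding eventually_sequentially by blast
  have "c / 2 \<le> (\<integral>x. (bump (real (Suc n)) x)\<^sup>2 * E x \<partial>lborel) / 2"
    using lower[of "real (Suc n)"] n(2) by simp
  also have "\<dots> \<le> K * (2 * \<delta> * V + \<delta> powr (1 - p) * J (real (Suc n)))"
    unfolding K_def V_def J_def h_def
    by (rule cutoff_energy_bound[OF dim p G div E u C bound int _ \<delta>]) simp_all
  also have "\<dots> = K * (2 * \<delta> * V) + K * \<delta> powr (1 - p) * J (real (Suc n))"
    by (simp add: algebra_simps)
  also have "\<dots> < c / 8 + c / 8"
    using \<delta>_small n(1) by linarith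
  finally show False using c by simp
qed

subsection \<open>Stationary barotropic flows\<close>

lemma constant_integrable_powr_zero:
  assumes "integrable lborel (\<lambda>x::'a::euclidean_space. c powr p)" "0 \<le> (c::real)"
  shows "c = 0"
proof (rule ccontr)
  assume "c \<noteq> 0"
  then have "c powr p > 0" using assms(2) by simp
  moreover have "(\<integral>\<^sup>+ (x::'a). ennreal (norm (c powr p)) \<partial>lborel) < \<infinity>"
    using assms(1) unfolding integrable_iff_bounded by blast
  ultimately show False by (simp add: ennreal_mult_top)
qed

lemma norm_matrix_vector_bound:
  fixes W :: "'n::finite \<Rightarrow> 'n \<Rightarrow> real" and w :: "real^'n"
  assumes "\<And>i j. \<bar>W i j\<bar> \<le> b"
  shows "norm (\<chi> i. \<Sum>j\<in>UNIV. W i j * w $ j) \<le> (real CARD('n))\<^sup>2 * b * norm w"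
proof -
  have "norm (\<chi> i. \<Sum>j\<in>UNIV. W i j * w $ j) \<le> (\<Sum>i\<in>UNIV. \<bar>\<Sum>j\<in>UNIV. W i j * w $ j\<bar>)"
    using norm_le_l1_cart[of "\<chi> i. \<Sum>j\<in>UNIV. W i j * w $ j"] by simp
  also have "\<dots> \<le> (\<Sum>i\<in>(UNIV::'n set). \<Sum>j\<in>(UNIV::'n set). b * norm w)"
    using assms order_trans[OF abs_ge_zero assms]
    by (intro sum_mono order_trans[OF sum_abs]) (auto simp: abs_mult intro!: mult_mono component_le_norm_cart)
  also have "\<dots> = (real CARD('n))\<^sup>2 * b * norm w"
    by (simp add: power2_eq_square)
  finally show ?thesis .
qed

lemma abs_le_sqrt_double_sum:
  fixes W :: "'n::finite \<Rightarrow> 'n \<Rightarrow> real"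
  assumes "c * (\<Sum>i\<in>UNIV. \<Sum>j\<in>UNIV. (W i j)\<^sup>2) \<le> e" "0 < c"
  shows "\<bar>W i j\<bar> \<le> sqrt (1 / c) * sqrt e"
proof -
  have "(W i j)\<^sup>2 \<le> (\<Sum>j\<in>UNIV. (W i j)\<^sup>2)"
    by (rule member_le_sum) auto
  also have "\<dots> \<le> (\<Sum>i\<in>UNIV. \<Sum>j\<in>UNIV. (W i j)\<^sup>2)"
    by (rule member_le_sum[of i UNIV "\<lambda>i. \<Sum>j\<in>UNIV. (W i j)\<^sup>2"]) (auto intro: sum_nonneg)
  also have "\<dots> \<le> 1 / c * e"
    using assms by (simp add: field_simps)
  finally have "sqrt ((W i j)\<^sup>2) \<le> sqrt (1 / c * e)"
    by (rule real_sqrt_le_mono)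
  then show ?thesis by (simp add: real_sqrt_mult real_sqrt_divide)
qed

lemma double_sum_squares_eq_0:
  fixes W :: "'n::finite \<Rightarrow> 'n \<Rightarrow> real"
  assumes "(\<Sum>i\<in>UNIV. \<Sum>j\<in>UNIV. (W i j)\<^sup>2) = 0"
  shows "W i j = 0"
  using abs_le_sqrt_double_sum[of 1 W 0 i j] assms by simp

text \<open>The locale holds the equations with their pointwise regularity; dimension, the density
  bound and integrability are added where estimates begin.\<close>

locale barotropic_flow =
  fixes rho :: "real^'n::finite \<Rightarrow> real" and v :: "real^'n \<Rightarrow> real^'n"
    and mu lam A gam :: real
  assumes params: "mu > 0" "lam + 2 * mu > 0" "A > 0" "gam > 1"
    and rho_nonneg: "\<forall>x. rho x \<ge> 0"
    and smooth_rho: "smooth rho"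
    and smooth_v: "smooth_field v"
    and P_diff: "\<forall>x. (\<lambda>y. A * rho y powr gam) differentiable (at x)"
    and mass: "\<forall>x. (\<Sum>i\<in>UNIV. partial i (\<lambda>y. rho y * v y $ i) x) = 0"
    and momentum: "\<forall>x j.
        (\<Sum>i\<in>UNIV. partial i (\<lambda>y. rho y * v y $ i * v y $ j) x)
      = - partial j (\<lambda>y. A * rho y powr gam) x
        + mu * (\<Sum>i\<in>UNIV. partial i (partial i (\<lambda>y. v y $ j)) x)
        + (mu + lam) * partial j (\<lambda>y. \<Sum>i\<in>UNIV. partial i (\<lambda>z. v z $ i) y) x"
begin

abbreviation P :: "real^'n \<Rightarrow> real" where
  "P \<equiv> \<lambda>y. A * rho y powr gam"

abbreviation J :: "'n \<Rightarrow> 'n \<Rightarrow> real^'n \<Rightarrow> real" where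
  "J i j \<equiv> partial i (\<lambda>y. v y $ j)"

section \<open>The equations in terms of vorticity and divergence\<close>

definition dv :: "real^'n \<Rightarrow> real" where
  "dv = (\<lambda>y. \<Sum>i\<in>UNIV. J i i y)"

definition W :: "'n \<Rightarrow> 'n \<Rightarrow> real^'n \<Rightarrow> real" where
  "W i j = (\<lambda>y. J i j y - J j i y)"

lemma smooth_comp: "smooth (\<lambda>y. v y $ j)"
  using smooth_v by (simp add: smooth_field_def)

lemma C1_v: "C1 (\<lambda>y. v y $ j)" and C1_rho: "C1 rho" and C1_J: "C1 (J i j)"
  by (simp_all add: smooth_imp_C1 smooth_partial smooth_comp smooth_rho)

lemma C1_dv: "C1 dv" and C1_W: "C1 (W i j)"
  unfolding dv_def W_def by (simp_all add: C1_J C1_intros)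

lemmas flow_C1 = C1_v C1_rho C1_J C1_dv C1_W

lemma partial_dv: "partial j dv x = (\<Sum>i\<in>UNIV. partial j (J i i) x)"
  unfolding dv_def by (simp add: partial_sum C1_J)

lemma partial_W: "partial k (W i j) x = partial k (J i j) x - partial k (J j i) x"
  unfolding W_def by (simp add: partial_diff C1_J)

lemma divergence_transposed_gradient: "(\<Sum>i\<in>UNIV. partial i (J j i) x) = partial j dv x"
  unfolding partial_dv using partial_commute[OF smooth_comp] by simp

lemma mass_expanded: "(\<Sum>i\<in>UNIV. partial i rho x * v x $ i) = - (rho x * dv x)"
proof -
  have "0 = (\<Sum>i\<in>UNIV. rho x * J i i x + partial i rho x * v x $ i)"
    using mass by (simp add: partial_mult flow_C1)
  then show ?thesis
    by (simp add: sum.distrib sum_distrib_left dv_def)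
qed

text \<open>The part of the product rule in which the divergence falls on \<open>rho * v\<close>
  vanishes by the mass equation.\<close>

lemma convection: "(\<Sum>i\<in>UNIV. partial i (\<lambda>y. rho y * v y $ i * v y $ j) x)
    = rho x * (\<Sum>i\<in>UNIV. v x $ i * J i j x)"
proof -
  have "(\<Sum>i\<in>UNIV. partial i (\<lambda>y. rho y * v y $ i * v y $ j) x)
      = (\<Sum>i\<in>UNIV. rho x * (v x $ i * J i j x) + partial i (\<lambda>y. rho y * v y $ i) x * v x $ j)"
    by (intro sum.cong refl) (simp add: partial_mult[OF C1_mult[OF C1_rho C1_v] C1_v])
  also have "\<dots> = rho x * (\<Sum>i\<in>UNIV. v x $ i * J i j x)
      + (\<Sum>i\<in>UNIV. partial i (\<lambda>y. rho y * v y $ i) x) * v x $ j"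
    by (simp only: sum.distrib sum_distrib_left sum_distrib_right)
  finally show ?thesis using mass by simp
qed

text \<open>The Laplacian of \<open>v\<close> is the divergence of \<open>W\<close> plus the
  gradient of \<open>dv\<close>, because derivatives commute. The coefficients \<open>mu\<close> and
  \<open>mu + lam\<close> of the latter add up to \<open>2 * mu + lam\<close>.\<close>

lemma momentum_rewritten: "rho x * (\<Sum>i\<in>UNIV. v x $ i * J i j x)
    = - partial j P x + mu * (\<Sum>i\<in>UNIV. partial i (W i j) x) + (2 * mu + lam) * partial j dv x"
proof -
  have "(\<Sum>i\<in>UNIV. partial i (J i j) x) = (\<Sum>i\<in>UNIV. partial i (W i j) x) + partial j dv x"
    by (simp add: partial_W sum_subtractf divergence_transposed_gradient)
  moreover have "rho x * (\<Sum>i\<in>UNIV. v x $ i * J i j x)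
    = - partial j P x + mu * (\<Sum>i\<in>UNIV. partial i (J i j) x) + (mu + lam) * partial j dv x"
    using momentum[rule_format, of j x] unfolding convection dv_def[symmetric] .
  ultimately show ?thesis by (simp add: algebra_simps)
qed

text \<open>The momentum equation expresses the pressure gradient through continuous functions,
  which yields continuity across the vacuum set without differentiating the power there.\<close>

lemma C1_P: "C1 P"
proof (rule C1I)
  show "P differentiable (at x)" for x using P_diff by blast
  show "partial j P x = mu * (\<Sum>i\<in>UNIV. partial i (W i j) x) + (2 * mu + lam) * partial j dv x
      - rho x * (\<Sum>i\<in>UNIV. v x $ i * J i j x)" for j x
    using momentum_rewritten[of x j] by simp
  show "continuous_on UNIV (\<lambda>x. mu * (\<Sum>i\<in>UNIV. partial i (W i j) x)
      + (2 * mu + lam) * partial j dv x - rho x * (\<Sum>i\<in>UNIV. v x $ i * J i j x))" for j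
    by (intro continuous_intros C1_continuous_partial C1_continuous flow_C1)
qed

lemma partial_P_vacuum:
  assumes "rho x = 0"
  shows "partial i P x = 0"
proof -
  have "frechet_derivative P (at x) = (\<lambda>h. 0)"
    by (rule differential_zero_maxmin[of x UNIV P])
      (use has_derivative_C1[OF C1_P] assms params in auto)
  then show ?thesis by (simp add: partial_def)
qed

text \<open>The chain rule is multiplied by \<open>rho x\<close> so that it also holds in the
  vacuum, where both sides are zero.\<close>

lemma rho_partial_P: "rho x * partial i P x = gam * P x * partial i rho x"
proof (cases "rho x = 0")
  case False
  then have pos: "rho x > 0" using rho_nonneg by (simp add: order_less_le)
  have "((\<lambda>r. A * r powr gam) has_derivative (\<lambda>h. A * (gam * rho x powr (gam - 1)) * h)) (at (rho x))"
    using DERIV_cmult[OF has_real_derivative_powr[OF pos, of gam], of A]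
    unfolding has_field_derivative_def .
  from has_derivative_compose[OF has_derivative_C1[OF C1_rho] this]
  have "partial i P x = A * (gam * rho x powr (gam - 1)) * partial i rho x"
    unfolding partial_def[of i rho] by (rule partial_eqI)
  moreover have "rho x powr gam = rho x * rho x powr (gam - 1)"
    using pos by (simp add: powr_mult_base)
  ultimately show ?thesis by simp
qed (use params in simp)

text \<open>Both sides vanish in the vacuum, since the pressure attains its minimum there. Elsewhere,
  multiply by the density and use the mass equation.\<close>

lemma pressure_work: "(\<Sum>i\<in>UNIV. partial i P x * v x $ i) = - (gam * P x * dv x)"
proof (cases "rho x = 0")
  case True
  then show ?thesis using params partial_P_vacuum[OF True] by simp
next
  case False
  have "rho x * (\<Sum>i\<in>UNIV. partial i P x * v x $ i)
      = gam * P x * (\<Sum>i\<in>UNIV. partial i rho x * v x $ i)"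
    unfolding sum_distrib_left using rho_partial_P[of x] by (simp only: mult.assoc[symmetric])
  also have "\<dots> = rho x * - (gam * P x * dv x)"
    unfolding mass_expanded by simp
  finally show ?thesis using False by (simp only: mult_cancel_left) simp
qed

section \<open>Energy density, flux and the energy identity\<close>

definition E :: "real^'n \<Rightarrow> real" where
  "E x = mu / 2 * (\<Sum>i\<in>UNIV. \<Sum>j\<in>UNIV. (W i j x)\<^sup>2) + (2 * mu + lam) * (dv x)\<^sup>2"

text \<open>Kinetic energy flux, enthalpy flux and the two viscous fluxes. The factor
  \<open>gam / (gam - 1)\<close> makes the divergence of the enthalpy flux equal to \<open>v\<close>
  dotted with the pressure gradient, since \<open>pressure_work\<close> gives
  \<open>div (P v) = (1 - gam) * P * dv\<close>.\<close>

definition G :: "real^'n \<Rightarrow> real^'n" where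
  "G x = (\<chi> i. rho x * v x $ i * (\<Sum>j\<in>UNIV. v x $ j * v x $ j) / 2
    + gam / (gam - 1) * (P x * v x $ i)
    - mu * (\<Sum>j\<in>UNIV. W i j x * v x $ j) - (2 * mu + lam) * (dv x * v x $ i))"

lemma G_nth: "(\<lambda>y. G y $ i) = (\<lambda>x. 1 / 2 * ((rho x * v x $ i) * (\<Sum>j\<in>UNIV. v x $ j * v x $ j))
    + gam / (gam - 1) * (P x * v x $ i)
    - mu * (\<Sum>j\<in>UNIV. W i j x * v x $ j) - (2 * mu + lam) * (dv x * v x $ i))"
  by (simp add: G_def)

lemma C1_G: "C1 (\<lambda>y. G y $ i)"
  unfolding G_nth by (intro C1_intros flow_C1 C1_P finite)

text \<open>As \<open>W\<close> is antisymmetric, exchanging the indices replaces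
  \<open>J i j\<close> by \<open>- J j i\<close>; averaging both expressions leaves half of
  \<open>W\<close> squared.\<close>

lemma vorticity_pairing:
  "(\<Sum>i\<in>UNIV. \<Sum>j\<in>UNIV. W i j x * J i j x) = (\<Sum>i\<in>UNIV. \<Sum>j\<in>UNIV. (W i j x)\<^sup>2) / 2"
proof -
  have "(\<Sum>i\<in>UNIV. \<Sum>j\<in>UNIV. W i j x * J i j x) = (\<Sum>i\<in>UNIV. \<Sum>j\<in>UNIV. W j i x * J j i x)"
    by (rule sum.swap)
  also have "\<dots> = (\<Sum>i\<in>UNIV. \<Sum>j\<in>UNIV. - (W i j x * J j i x))"
    by (simp add: W_def algebra_simps)
  finally have "2 * (\<Sum>i\<in>UNIV. \<Sum>j\<in>UNIV. W i j x * J i j x)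
      = (\<Sum>i\<in>UNIV. \<Sum>j\<in>UNIV. W i j x * J i j x) + (\<Sum>i\<in>UNIV. \<Sum>j\<in>UNIV. - (W i j x * J j i x))"
    by simp
  also have "\<dots> = (\<Sum>i\<in>UNIV. \<Sum>j\<in>UNIV. (W i j x)\<^sup>2)"
    unfolding sum.distrib[symmetric]
    by (intro sum.cong refl) (simp add: W_def power2_eq_square algebra_simps)
  finally show ?thesis by simp
qed

text \<open>Each flux yields \<open>v\<close> times one term of the momentum equation, and the
  viscous ones also yield the squares in \<open>E\<close>. The products with \<open>v\<close> cancel
  by the momentum equation.\<close>

lemma divergence_G: "(\<Sum>i\<in>UNIV. partial i (\<lambda>y. G y $ i) x) = - E x"
proof -
  let ?q = "\<lambda>x. \<Sum>j\<in>UNIV. v x $ j * v x $ j"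
  have q: "partial i ?q x = 2 * (\<Sum>j\<in>UNIV. v x $ j * J i j x)" for i
    by (simp add: partial_sum partial_mult flow_C1 C1_intros sum_distrib_left sum.distrib[symmetric])
  \<comment> \<open>The mass equation removes the derivative of \<open>rho * v\<close>; exchanging
    the sums then exhibits the convective term.\<close>
  have kin: "(\<Sum>i\<in>UNIV. partial i (\<lambda>x. (rho x * v x $ i) * ?q x) x)
      = 2 * (\<Sum>j\<in>UNIV. v x $ j * (rho x * (\<Sum>i\<in>UNIV. v x $ i * J i j x)))"
  proof -
    have "(\<Sum>i\<in>UNIV. partial i (\<lambda>x. (rho x * v x $ i) * ?q x) x)
        = (\<Sum>i\<in>UNIV. rho x * v x $ i * (2 * (\<Sum>j\<in>UNIV. v x $ j * J i j x))
            + partial i (\<lambda>y. rho y * v y $ i) x * ?q x)"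
      by (simp only: partial_mult[of "\<lambda>x. rho x * v x $ i" "?q" for i] flow_C1 C1_intros finite q)
    also have "\<dots> = (\<Sum>i\<in>UNIV. rho x * v x $ i * (2 * (\<Sum>j\<in>UNIV. v x $ j * J i j x)))"
      unfolding sum.distrib sum_distrib_right[symmetric] using mass by simp
    also have "\<dots> = (\<Sum>i\<in>UNIV. \<Sum>j\<in>UNIV. 2 * (v x $ j * (rho x * (v x $ i * J i j x))))"
      by (simp add: sum_distrib_left mult_ac)
    also have "\<dots> = (\<Sum>j\<in>UNIV. \<Sum>i\<in>UNIV. 2 * (v x $ j * (rho x * (v x $ i * J i j x))))"
      by (rule sum.swap)
    finally show ?thesis by (simp add: sum_distrib_left)
  qed
  have pres: "gam / (gam - 1) * (\<Sum>i\<in>UNIV. partial i (\<lambda>x. P x * v x $ i) x)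
      = (\<Sum>i\<in>UNIV. partial i P x * v x $ i)"
  proof -
    have "(\<Sum>i\<in>UNIV. partial i (\<lambda>x. P x * v x $ i) x)
        = P x * dv x + (\<Sum>i\<in>UNIV. partial i P x * v x $ i)"
      by (simp only: partial_mult[OF C1_P C1_v] sum.distrib dv_def sum_distrib_left)
    \<comment> \<open>Here \<open>p\<close> stands for \<open>P x * dv x\<close> and
      \<open>t\<close> for the pressure work, so that \<open>s = (1 - gam) * p\<close>.\<close>
    moreover have "gam / (gam - 1) * s = t" if "s = p + t" "t = - (gam * p)" for s t p :: real
      unfolding that using params by (simp add: field_simps)
    ultimately show ?thesis
      using pressure_work[of x] by (simp only: mult.assoc)
  qed
  have vort: "(\<Sum>i\<in>UNIV. partial i (\<lambda>x. \<Sum>j\<in>UNIV. W i j x * v x $ j) x)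
      = (\<Sum>i\<in>UNIV. \<Sum>j\<in>UNIV. (W i j x)\<^sup>2) / 2
        + (\<Sum>j\<in>UNIV. v x $ j * (\<Sum>i\<in>UNIV. partial i (W i j) x))"
  proof -
    have "(\<Sum>i\<in>UNIV. partial i (\<lambda>x. \<Sum>j\<in>UNIV. W i j x * v x $ j) x)
        = (\<Sum>i\<in>UNIV. \<Sum>j\<in>UNIV. W i j x * J i j x)
          + (\<Sum>i\<in>UNIV. \<Sum>j\<in>UNIV. v x $ j * partial i (W i j) x)"
      by (simp add: partial_sum partial_mult flow_C1 C1_intros sum.distrib mult_ac)
    also have "(\<Sum>i\<in>UNIV. \<Sum>j\<in>UNIV. v x $ j * partial i (W i j) x)
        = (\<Sum>j\<in>UNIV. \<Sum>i\<in>UNIV. v x $ j * partial i (W i j) x)"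
      by (rule sum.swap)
    finally show ?thesis
      by (simp add: vorticity_pairing sum_distrib_left)
  qed
  have comp: "(\<Sum>i\<in>UNIV. partial i (\<lambda>x. dv x * v x $ i) x)
      = (dv x)\<^sup>2 + (\<Sum>j\<in>UNIV. v x $ j * partial j dv x)"
    by (simp add: partial_mult flow_C1 sum.distrib sum_distrib_left[symmetric] dv_def[symmetric]
        power2_eq_square mult.commute fun_cong[OF dv_def, symmetric])
  have "partial i (\<lambda>y. G y $ i) x = 1 / 2 * partial i (\<lambda>x. (rho x * v x $ i) * ?q x) x
        + gam / (gam - 1) * partial i (\<lambda>x. P x * v x $ i) x
        - mu * partial i (\<lambda>x. \<Sum>j\<in>UNIV. W i j x * v x $ j) x
        - (2 * mu + lam) * partial i (\<lambda>x. dv x * v x $ i) x" for i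
    unfolding G_nth
    by (simp only: partial_add partial_diff partial_cmult flow_C1 C1_P C1_intros finite)
  then have "(\<Sum>i\<in>UNIV. partial i (\<lambda>y. G y $ i) x)
      = 1 / 2 * (\<Sum>i\<in>UNIV. partial i (\<lambda>x. (rho x * v x $ i) * ?q x) x)
        + gam / (gam - 1) * (\<Sum>i\<in>UNIV. partial i (\<lambda>x. P x * v x $ i) x)
        - mu * (\<Sum>i\<in>UNIV. partial i (\<lambda>x. \<Sum>j\<in>UNIV. W i j x * v x $ j) x)
        - (2 * mu + lam) * (\<Sum>i\<in>UNIV. partial i (\<lambda>x. dv x * v x $ i) x)"
    by (simp only: sum.distrib sum_subtractf sum_distrib_left[symmetric])
  also have "\<dots> = (\<Sum>j\<in>UNIV. v x $ j * (rho x * (\<Sum>i\<in>UNIV. v x $ i * J i j x)))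
        + (\<Sum>i\<in>UNIV. partial i P x * v x $ i)
        - mu * (\<Sum>j\<in>UNIV. v x $ j * (\<Sum>i\<in>UNIV. partial i (W i j) x))
        - (2 * mu + lam) * (\<Sum>j\<in>UNIV. v x $ j * partial j dv x) - E x"
    unfolding kin pres vort comp E_def by (simp add: algebra_simps)
  also have "(\<Sum>j\<in>UNIV. v x $ j * (rho x * (\<Sum>i\<in>UNIV. v x $ i * J i j x)))
      = - (\<Sum>i\<in>UNIV. partial i P x * v x $ i)
        + mu * (\<Sum>j\<in>UNIV. v x $ j * (\<Sum>i\<in>UNIV. partial i (W i j) x))
        + (2 * mu + lam) * (\<Sum>j\<in>UNIV. v x $ j * partial j dv x)"
  proof -
    have "v x $ j * (rho x * (\<Sum>i\<in>UNIV. v x $ i * J i j x)) = - (partial j P x * v x $ j)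
        + mu * (v x $ j * (\<Sum>i\<in>UNIV. partial i (W i j) x))
        + (2 * mu + lam) * (v x $ j * partial j dv x)" for j
      unfolding momentum_rewritten by (simp add: algebra_simps)
    then show ?thesis
      by (simp only: sum.distrib sum_negf sum_distrib_left[symmetric])
  qed
  finally show ?thesis by simp
qed

lemma E_nonneg: "0 \<le> E x"
  using params by (simp add: E_def sum_nonneg)

text \<open>With bounded density the kinetic flux is cubic and the enthalpy flux linear in
  \<open>v\<close>; the viscous fluxes multiply \<open>v\<close> by quantities whose squares
  \<open>E\<close> controls.\<close>

lemma G_bound:
  assumes "bounded (range rho)"
  obtains C where "0 \<le> C"
    "\<And>x. norm (G x) \<le> C * (sqrt (E x) * norm (v x) + norm (v x) + norm (v x) ^ 3)"
proof -
  obtain M where M: "\<And>x. rho x \<le> M"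
    using assms unfolding bounded_iff by (metis abs_le_D1 rangeI real_norm_def)
  then have M0: "0 \<le> M" using rho_nonneg order_trans by blast
  define c2 where "c2 = gam / (gam - 1) * (A * M powr gam)"
  \<comment> \<open>The coefficient \<open>2 * mu + lam\<close> is \<open>c3\<close> squared: one
    factor \<open>c3\<close> goes with \<open>dv\<close> to be bounded by \<open>sqrt (E x)\<close>,
    the other remains.\<close>
  define c3 where "c3 = sqrt (2 * mu + lam)"
  \<comment> \<open>Entries of \<open>W\<close> are at most
    \<open>sqrt (2 / mu) * sqrt (E x)\<close>; the crude bound for matrix times vector costs the
    squared dimension.\<close>
  define c4 where "c4 = mu * ((real CARD('n))\<^sup>2 * sqrt (1 / (mu / 2)))"
  have k: "2 * mu + lam > 0" using params by simp
  have nn: "0 \<le> c2" "0 \<le> c3" "0 \<le> c4"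
    using params k by (simp_all add: c2_def c3_def c4_def)
  define C where "C = M / 2 + c2 + c3 + c4"
  have C: "0 \<le> C" using nn M0 by (simp add: C_def)
  have "norm (G x) \<le> C * (sqrt (E x) * norm (v x) + norm (v x) + norm (v x) ^ 3)" for x
  proof -
    let ?u = "norm (v x)" and ?s = "sqrt (E x)"
    let ?w = "\<chi> i. \<Sum>j\<in>UNIV. W i j x * v x $ j"
    have vv: "(\<Sum>j\<in>UNIV. v x $ j * v x $ j) = ?u\<^sup>2"
      by (simp add: power2_norm_eq_inner inner_vec_def)
    have "G x = (rho x * ?u\<^sup>2 / 2 + gam / (gam - 1) * P x - (2 * mu + lam) * dv x) *\<^sub>R v x - mu *\<^sub>R ?w"
      by (simp add: vec_eq_iff G_def vv algebra_simps)
    then have "norm (G x) \<le> \<bar>rho x * ?u\<^sup>2 / 2 + gam / (gam - 1) * P x - (2 * mu + lam) * dv x\<bar> * ?u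
        + mu * norm ?w"
      using params norm_triangle_ineq4[of "(rho x * ?u\<^sup>2 / 2 + gam / (gam - 1) * P x
        - (2 * mu + lam) * dv x) *\<^sub>R v x" "mu *\<^sub>R ?w"] by simp
    also have "\<dots> \<le> (M / 2 * ?u\<^sup>2 + c2 + c3 * ?s) * ?u + c4 * ?s * ?u"
    proof (intro add_mono mult_right_mono)
      have 1: "\<bar>rho x * ?u\<^sup>2 / 2\<bar> \<le> M / 2 * ?u\<^sup>2"
        using M[of x] rho_nonneg by (simp add: abs_mult mult_right_mono)
      have "rho x powr gam \<le> M powr gam"
        using M[of x] rho_nonneg params by (intro powr_mono2) auto
      then have 2: "\<bar>gam / (gam - 1) * P x\<bar> \<le> c2"
        using params unfolding c2_def by (simp add: abs_mult mult_left_mono divide_right_mono)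
      have "(2 * mu + lam) * (dv x)\<^sup>2 \<le> E x"
        using params by (simp add: E_def sum_nonneg)
      then have "sqrt ((2 * mu + lam) * (dv x)\<^sup>2) \<le> ?s"
        by (rule real_sqrt_le_mono)
      then have "c3 * (c3 * \<bar>dv x\<bar>) \<le> c3 * ?s"
        unfolding c3_def using k by (intro mult_left_mono) (simp_all add: real_sqrt_mult)
      then have 3: "\<bar>(2 * mu + lam) * dv x\<bar> \<le> c3 * ?s"
        unfolding c3_def using k by (simp add: abs_mult mult.assoc[symmetric])
      show "\<bar>rho x * ?u\<^sup>2 / 2 + gam / (gam - 1) * P x - (2 * mu + lam) * dv x\<bar>
          \<le> M / 2 * ?u\<^sup>2 + c2 + c3 * ?s"
        using 1 2 3 by linarith
      have "mu / 2 * (\<Sum>i\<in>UNIV. \<Sum>j\<in>UNIV. (W i j x)\<^sup>2) \<le> E x"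
        using k by (simp add: E_def)
      then have "\<bar>W i j x\<bar> \<le> sqrt (1 / (mu / 2)) * ?s" for i j
        using params by (intro abs_le_sqrt_double_sum) auto
      then have "norm ?w \<le> (real CARD('n))\<^sup>2 * (sqrt (1 / (mu / 2)) * ?s) * ?u"
        by (rule norm_matrix_vector_bound)
      then have "mu * norm ?w \<le> mu * ((real CARD('n))\<^sup>2 * (sqrt (1 / (mu / 2)) * ?s) * ?u)"
        using params by (intro mult_left_mono) auto
      then show "mu * norm ?w \<le> c4 * ?s * ?u"
        unfolding c4_def by (simp only: mult.assoc)
    qed simp
    also have "\<dots> = M / 2 * ?u ^ 3 + c2 * ?u + (c3 + c4) * (?s * ?u)"
      by (simp add: power2_eq_square power3_eq_cube algebra_simps)
    also have "\<dots> \<le> C * ?u ^ 3 + C * ?u + C * (?s * ?u)"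
      using nn M0 E_nonneg[of x] by (intro add_mono mult_right_mono) (auto simp: C_def)
    finally show ?thesis by (simp add: algebra_simps)
  qed
  with C show ?thesis by (rule that)
qed

section \<open>Rigidity: vanishing velocity and constant density\<close>

lemma vorticity_divergence_vanish:
  assumes dim: "2 \<le> CARD('n)" and p: "p = real CARD('n) / (real CARD('n) - 1)"
    and "bounded (range rho)"
    and int: "integrable lborel (\<lambda>x. norm (v x) powr p)"
      "integrable lborel (\<lambda>x. norm (v x) powr (3 * p))"
  shows "W i j x = 0" "dv x = 0"
proof -
  obtain C where C: "0 \<le> C"
    "\<And>x. norm (G x) \<le> C * (sqrt (E x) * norm (v x) + norm (v x) + norm (v x) ^ 3)"
    using G_bound[OF assms(3)] by blast
  have "E x = 0"
    by (rule critical_caccioppoli_vanishing[OF dim p C1_G divergence_G E_nonneg norm_ge_zero C int])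
  moreover have "0 \<le> mu / 2 * (\<Sum>i\<in>UNIV. \<Sum>j\<in>UNIV. (W i j x)\<^sup>2)"
    "0 \<le> (2 * mu + lam) * (dv x)\<^sup>2"
    using params by (simp_all add: sum_nonneg)
  ultimately have "mu / 2 * (\<Sum>i\<in>UNIV. \<Sum>j\<in>UNIV. (W i j x)\<^sup>2) = 0"
    "(2 * mu + lam) * (dv x)\<^sup>2 = 0"
    unfolding E_def by linarith+
  then have "(\<Sum>i\<in>UNIV. \<Sum>j\<in>UNIV. (W i j x)\<^sup>2) = 0" "dv x = 0"
    using params by simp_all
  then show "W i j x = 0" "dv x = 0"
    using double_sum_squares_eq_0[of "\<lambda>i j. W i j x"] by auto
qed

text \<open>Without vorticity and divergence every component of the velocity is harmonic, so the
  vanishing theorem applies to the flux \<open>- (\<nabla>v) v\<close> with energy density \<open>\<bar>\<nabla>v\<bar>\<^sup>2\<close>.\<close>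

lemma gradient_vanishes:
  assumes dim: "2 \<le> CARD('n)" and p: "p = real CARD('n) / (real CARD('n) - 1)"
    and "bounded (range rho)"
    and int: "integrable lborel (\<lambda>x. norm (v x) powr p)"
      "integrable lborel (\<lambda>x. norm (v x) powr (3 * p))"
  shows "J i j x = 0"
proof -
  note vanish = vorticity_divergence_vanish[OF assms]
  have J_sym: "J i j = J j i" for i j
    using vanish(1)[of i j] by (simp add: W_def fun_eq_iff)
  have harmonic: "(\<Sum>i\<in>UNIV. partial i (J i j) x) = 0" for j x
  proof -
    have "dv = (\<lambda>x. 0)" using vanish(2) by blast
    then have "partial j dv x = 0" by (simp add: partial_const)
    \<comment> \<open>Symmetry of the gradient turns the Laplacian into the divergence of the
      transposed gradient, which is the gradient of \<open>dv\<close>.\<close>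
    moreover have "partial i (J i j) x = partial i (J j i) x" for i
      by (subst J_sym) (rule refl)
    ultimately show ?thesis
      by (simp only: divergence_transposed_gradient)
  qed
  define H where "H = (\<lambda>x. \<chi> i. \<Sum>j\<in>UNIV. - J i j x * v x $ j)"
  define D where "D = (\<lambda>x. \<Sum>i\<in>UNIV. \<Sum>j\<in>UNIV. (J i j x)\<^sup>2)"
  have H_nth: "(\<lambda>y. H y $ i) = (\<lambda>x. \<Sum>j\<in>UNIV. - J i j x * v x $ j)" for i
    by (simp add: H_def)
  have C1_H: "C1 (\<lambda>y. H y $ i)" for i
    unfolding H_nth by (intro C1_intros flow_C1 finite)
  have div: "(\<Sum>i\<in>UNIV. partial i (\<lambda>y. H y $ i) x) = - D x" for x
  proof -
    have "(\<Sum>i\<in>UNIV. partial i (\<lambda>y. H y $ i) x)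
        = (\<Sum>i\<in>UNIV. \<Sum>j\<in>UNIV. - (J i j x)\<^sup>2 + - (v x $ j) * partial i (J i j) x)"
      unfolding H_nth
      by (simp add: partial_sum partial_mult partial_minus flow_C1 C1_intros power2_eq_square
          algebra_simps)
    also have "\<dots> = - D x + (\<Sum>i\<in>UNIV. \<Sum>j\<in>UNIV. - (v x $ j) * partial i (J i j) x)"
      by (simp add: D_def sum.distrib sum_negf sum_subtractf)
    also have "(\<Sum>i\<in>UNIV. \<Sum>j\<in>UNIV. - (v x $ j) * partial i (J i j) x)
        = (\<Sum>j\<in>UNIV. \<Sum>i\<in>UNIV. - (v x $ j) * partial i (J i j) x)"
      by (rule sum.swap)
    also have "\<dots> = 0"
      unfolding sum_distrib_left[symmetric] harmonic by simp
    finally show ?thesis by simp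
  qed
  have D_nonneg: "0 \<le> D x" for x
    by (simp add: D_def sum_nonneg)
  have bound: "norm (H x) \<le> (real CARD('n))\<^sup>2 * (sqrt (D x) * norm (v x) + norm (v x) + norm (v x) ^ 3)" for x
  proof -
    have "\<bar>- J i j x\<bar> \<le> sqrt (D x)" for i j
      using abs_le_sqrt_double_sum[of 1 "\<lambda>i j. J i j x" "D x" i j] by (simp add: D_def)
    then have "norm (H x) \<le> (real CARD('n))\<^sup>2 * sqrt (D x) * norm (v x)"
      unfolding H_def by (rule norm_matrix_vector_bound)
    also have "\<dots> = (real CARD('n))\<^sup>2 * (sqrt (D x) * norm (v x))"
      by simp
    also have "\<dots> \<le> (real CARD('n))\<^sup>2 * (sqrt (D x) * norm (v x) + norm (v x) + norm (v x) ^ 3)"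
      by (intro mult_left_mono) auto
    finally show ?thesis .
  qed
  have "D x = 0"
    by (rule critical_caccioppoli_vanishing[OF dim p C1_H div D_nonneg norm_ge_zero _ bound int]) simp
  then show ?thesis
    unfolding D_def by (rule double_sum_squares_eq_0)
qed

text \<open>A zero gradient makes \<open>v\<close> constant, and a nonzero constant has no
  integrable power on a space of infinite measure.\<close>

lemma velocity_vanishes:
  assumes dim: "2 \<le> CARD('n)" and p: "p = real CARD('n) / (real CARD('n) - 1)"
    and "bounded (range rho)"
    and int: "integrable lborel (\<lambda>x. norm (v x) powr p)"
      "integrable lborel (\<lambda>x. norm (v x) powr (3 * p))"
  shows "v x = 0"
proof -
  have "\<exists>c. \<forall>x. v x $ j = c" for j
    by (rule partial_zero_imp_constant[OF C1_differentiable[OF C1_v] gradient_vanishes[OF assms]])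
  then obtain w where w: "\<And>x j. v x $ j = w j" by metis
  have v_const: "v y = v x" for y
    by (simp add: vec_eq_iff w)
  then have "(\<lambda>y. norm (v y) powr p) = (\<lambda>y. norm (v x) powr p)"
    by (intro ext) (rule arg_cong)
  then have "integrable lborel (\<lambda>y::real^'n. norm (v x) powr p)"
    using int(1) by argo
  then show ?thesis
    using constant_integrable_powr_zero[of "norm (v x)" p] by simp
qed

text \<open>At rest the momentum equation leaves only the pressure gradient, so the pressure is
  constant; on nonnegative densities it is inverted by the power \<open>1 / gam\<close>.\<close>

lemma density_constant_at_rest:
  assumes rest: "\<And>x. v x = 0"
  shows "\<exists>c. \<forall>x. rho x = c"
proof -
  have J0: "J i j = (\<lambda>x. 0)" for i j
    by (simp add: rest partial_const fun_eq_iff)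
  have "partial j P x = 0" for j x
    using momentum_rewritten[of x j] by (simp add: rest W_def dv_def J0 partial_const)
  then obtain c where c: "\<And>x. P x = c"
    using partial_zero_imp_constant[OF C1_differentiable[OF C1_P]] by blast
  have "rho x = (c / A) powr (1 / gam)" for x
  proof -
    have "rho x powr gam = c / A"
      using c[of x] params by (simp add: field_simps)
    then have "(c / A) powr (1 / gam) = rho x powr (gam * (1 / gam))"
      using powr_powr[of "rho x" gam "1 / gam"] by simp
    then show ?thesis using params rho_nonneg by simp
  qed
  then show ?thesis by blast
qed

end

theorem theorem1p2:
  fixes rho :: "real^'n::finite \<Rightarrow> real" and v :: "real^'n \<Rightarrow> real^'n"
    and mu lam A gam :: real
  assumes dim: "CARD('n) \<ge> 2"
    and params: "mu > 0" "lam + 2 * mu > 0" "A > 0" "gam > 1"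
    and rho_nonneg: "\<forall>x. rho x \<ge> 0"
    and smooth_rho: "smooth rho"
    and smooth_v: "smooth_field v"
    and P_diff: "\<forall>x. (\<lambda>y. A * rho y powr gam) differentiable (at x)"
    and mass: "\<forall>x. (\<Sum>i\<in>UNIV. partial i (\<lambda>y. rho y * v y $ i) x) = 0"
    and momentum: "\<forall>x j.
        (\<Sum>i\<in>UNIV. partial i (\<lambda>y. rho y * v y $ i * v y $ j) x)
      = - partial j (\<lambda>y. A * rho y powr gam) x
        + mu * (\<Sum>i\<in>UNIV. partial i (partial i (\<lambda>y. v y $ j)) x)
        + (mu + lam) * partial j (\<lambda>y. \<Sum>i\<in>UNIV. partial i (\<lambda>z. v z $ i) y) x"
    and rho_bdd: "bounded (range rho)"
    and v_L1: "integrable lborel (\<lambda>x. norm (v x) powr (real CARD('n) / (real CARD('n) - 1)))"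
    and v_L2: "integrable lborel (\<lambda>x. norm (v x) powr (3 * real CARD('n) / (real CARD('n) - 1)))"
  shows "(\<forall>x. v x = 0) \<and> (\<exists>c. \<forall>x. rho x = c)"
proof -
  interpret barotropic_flow rho v mu lam A gam
    using params rho_nonneg smooth_rho smooth_v P_diff mass momentum by unfold_locales
  define p where "p = real CARD('n) / (real CARD('n) - 1)"
  have int: "integrable lborel (\<lambda>x. norm (v x) powr p)"
    "integrable lborel (\<lambda>x. norm (v x) powr (3 * p))"
    using v_L1 v_L2 by (simp_all add: p_def)
  have "v x = 0" for x
    by (rule velocity_vanishes[OF dim p_def rho_bdd int])
  then show ?thesis
    using density_constant_at_rest by blast
qed

end
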